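(* Let $k$ be a field, let $\mathcal{H}$ be a simple hypergraph on the vertex set $V=\{x_1,\dots,x_n\}$, let $R=k[x_1,\dots,x_n]$, and let $I=I(\mathcal{H})\subseteq R$ be its edge ideal. If $\{E_1,\dots,E_c\}$ is a 2-collage in $\mathcal{H}$, then $\operatorname{reg}(R/I)\le\sum_{i=1}^c(|E_i|-1)$.
   Context: A hypergraph $\mathcal{H}=(V,\mathcal{E})$ consists of a finite vertex set $V$ and a collection $\mathcal{E}$ of nonempty subsets of $V$ (edges); it is simple if there are no containments $E\subsetneq E'$ between edges. The edge ideal is $I(\mathcal{H})=(\prod_{x\in E}x : E\in\mathcal{E})\subseteq R$, the vertices being identified with the variables. A 2-collage for $\mathcal{H}$ is a subset $\mathcal{C}\subseteq\mathcal{E}$ such that for every edge $E\in\mathcal{E}$ there is a vertex $v\in E$ and an edge $F\in\mathcal{C}$ with $E\setminus\{v\}\subseteq F$. $\operatorname{reg}$ denotes Castelnuovo–Mumford regularity: $\operatorname{reg}(M)=\max_i\{\max\{j:\operatorname{Tor}_i^R(M,k)_j\ne0\}-i\}$. *)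

theory Defs
  imports
    "HOL-Library.Poly_Mapping"
    "HOL-Library.Extended_Real"
    "HOL-Algebra.QuotRing"
    "HOL-Algebra.Module"
    "HOL-Algebra.Elementary_Groups"
begin

section \<open>Hypergraphs\<close>

definition hypergraph :: "'v set \<Rightarrow> 'v set set \<Rightarrow> bool" where
  "hypergraph V \<E> \<longleftrightarrow> finite V \<and> \<E> \<subseteq> Pow V \<and> {} \<notin> \<E>"

definition simple_hypergraph :: "'v set \<Rightarrow> 'v set set \<Rightarrow> bool" where
  "simple_hypergraph V \<E> \<longleftrightarrow> hypergraph V \<E> \<and> \<not> (\<exists>E\<in>\<E>. \<exists>E'\<in>\<E>. E \<subset> E')"

definition two_collage :: "'v set set \<Rightarrow> 'v set set \<Rightarrow> bool" where
  "two_collage \<E> \<C> \<longleftrightarrow> \<C> \<subseteq> \<E> \<and> (\<forall>E\<in>\<E>. \<exists>v\<in>E. \<exists>F\<in>\<C>. E - {v} \<subseteq> F)"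


section \<open>The polynomial ring \<open>k[V]\<close>\<close>

text \<open>
  A monomial is its finitely supported exponent vector; a polynomial is a finitely supported
  family of coefficients indexed by monomials, with the convolution product of
  \<^theory>\<open>HOL-Library.Poly_Mapping\<close>.
\<close>

type_synonym ('v, 'k) mpoly = "('v \<Rightarrow>\<^sub>0 nat) \<Rightarrow>\<^sub>0 'k"

definition poly_ring :: "'v set \<Rightarrow> ('v, 'k::field) mpoly ring" where
  "poly_ring V =
     \<lparr>carrier = {p. \<forall>m\<in>Poly_Mapping.keys p. Poly_Mapping.keys m \<subseteq> V},
      mult = (*), one = 1, zero = 0, add = (+)\<rparr>"

definition var :: "'v \<Rightarrow> ('v, 'k::field) mpoly" where
  "var x = Poly_Mapping.single (Poly_Mapping.single x 1) 1"

definition mon_deg :: "('v \<Rightarrow>\<^sub>0 nat) \<Rightarrow> nat" where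
  "mon_deg m = (\<Sum>x\<in>Poly_Mapping.keys m. Poly_Mapping.lookup m x)"

text \<open>The zero polynomial is homogeneous of every degree, negative degrees included.\<close>

definition homogeneous :: "int \<Rightarrow> ('v, 'k::field) mpoly \<Rightarrow> bool" where
  "homogeneous d p \<longleftrightarrow> (\<forall>m\<in>Poly_Mapping.keys p. int (mon_deg m) = d)"

definition const_coeff :: "('v, 'k::field) mpoly \<Rightarrow> 'k" where
  "const_coeff p = Poly_Mapping.lookup p 0"

definition edge_ideal :: "'v set \<Rightarrow> 'v set set \<Rightarrow> ('v, 'k::field) mpoly set" where
  "edge_ideal V \<E> = Idl\<^bsub>poly_ring V\<^esub> ((\<lambda>E. \<Prod>x\<in>E. var x) ` \<E>)"


section \<open>Graded modules and the quotient by an ideal\<close>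

record ('a, 'b) graded_module = "('a, 'b) module" +
  component :: "int \<Rightarrow> 'b set"

text \<open>\<open>R/I\<close> as a graded \<open>R\<close>-module, for \<open>R = k[V]\<close> and a homogeneous ideal \<open>I\<close>.\<close>

definition quot_module ::
  "'v set \<Rightarrow> ('v, 'k::field) mpoly set \<Rightarrow>
     (('v, 'k) mpoly, ('v, 'k) mpoly set) graded_module" where
  "quot_module V I = (let R = poly_ring V; Q = R Quot I in
     \<lparr>carrier = carrier Q, mult = mult Q, one = one Q, zero = zero Q, add = add Q,
      smult = (\<lambda>r X. (I +>\<^bsub>R\<^esub> r) \<otimes>\<^bsub>Q\<^esub> X),
      component = (\<lambda>d. {I +>\<^bsub>R\<^esub> p | p. p \<in> carrier R \<and> homogeneous d p})\<rparr>)"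


section \<open>Graded free resolutions\<close>

text \<open>
  A free module on a basis \<open>B \<subseteq> \<nat>\<close> is the set of finitely supported families indexed by \<open>B\<close>.
  \<open>lin_ext D\<close> is the linear map sending the basis element \<open>c\<close> to \<open>D c\<close>.
\<close>

definition free_module :: "'v set \<Rightarrow> nat set \<Rightarrow> (nat \<Rightarrow>\<^sub>0 ('v, 'k::field) mpoly) set" where
  "free_module V B =
     {f. Poly_Mapping.keys f \<subseteq> B \<and> (\<forall>b. Poly_Mapping.lookup f b \<in> carrier (poly_ring V))}"

definition lin_ext :: "(nat \<Rightarrow> (nat \<Rightarrow>\<^sub>0 'r)) \<Rightarrow> (nat \<Rightarrow>\<^sub>0 'r) \<Rightarrow> (nat \<Rightarrow>\<^sub>0 'r::comm_ring_1)" where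
  "lin_ext D f =
     (\<Sum>c\<in>Poly_Mapping.keys f. Poly_Mapping.map ((*) (Poly_Mapping.lookup f c)) (D c))"

text \<open>
  Data of an augmented complex \<open>\<dots> \<rightarrow> F\<^sub>2 \<rightarrow> F\<^sub>1 \<rightarrow> F\<^sub>0 \<rightarrow> M\<close> of graded free modules:
  \<open>F\<^sub>i\<close> has the basis \<open>basis F i\<close>, whose element \<open>b\<close> has degree \<open>bdeg F i b\<close>;
  \<open>diff F i c \<in> F\<^sub>i\<close> is the image of the basis element \<open>c\<close> of \<open>F\<^bsub>i+1\<^esub>\<close> (so \<open>diff F i\<close> gives the
  differential \<open>F\<^bsub>i+1\<^esub> \<rightarrow> F\<^sub>i\<close>), and \<open>aug F b \<in> M\<close> is the image of the basis element \<open>b\<close> of \<open>F\<^sub>0\<close>.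
\<close>

record (overloaded) ('v, 'k, 'm) free_complex =
  basis :: "nat \<Rightarrow> nat set"
  bdeg :: "nat \<Rightarrow> nat \<Rightarrow> int"
  diff :: "nat \<Rightarrow> nat \<Rightarrow> (nat \<Rightarrow>\<^sub>0 ('v, 'k) mpoly)"
  aug :: "nat \<Rightarrow> 'm"

definition aug_map ::
  "(('v, 'k::field) mpoly, 'm) graded_module \<Rightarrow> ('v, 'k, 'm) free_complex \<Rightarrow>
     (nat \<Rightarrow>\<^sub>0 ('v, 'k) mpoly) \<Rightarrow> 'm" where
  "aug_map M F f =
     finsum M (\<lambda>b. Poly_Mapping.lookup f b \<odot>\<^bsub>M\<^esub> aug F b) (Poly_Mapping.keys f)"

text \<open>
  Graded free resolutions of a graded \<open>k[V]\<close>-module \<open>M\<close>, with differentials and augmentation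
  of degree 0.  The bases are countable, possibly infinite, which suffices
  for every finitely generated \<open>M\<close>.
\<close>

definition graded_free_resolution ::
  "'v set \<Rightarrow> (('v, 'k::field) mpoly, 'm) graded_module \<Rightarrow> ('v, 'k, 'm) free_complex \<Rightarrow> bool" where
  "graded_free_resolution V M F \<longleftrightarrow>
     (\<forall>b\<in>basis F 0. aug F b \<in> component M (bdeg F 0 b)) \<and>
     (\<forall>i. \<forall>c\<in>basis F (Suc i).
        diff F i c \<in> free_module V (basis F i) \<and>
        (\<forall>b\<in>basis F i. homogeneous (bdeg F (Suc i) c - bdeg F i b) (Poly_Mapping.lookup (diff F i c) b))) \<and>
     aug_map M F ` free_module V (basis F 0) = carrier M \<and>
     {f \<in> free_module V (basis F 0). aug_map M F f = \<zero>\<^bsub>M\<^esub>} =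
       lin_ext (diff F 0) ` free_module V (basis F 1) \<and>
     (\<forall>i. {f \<in> free_module V (basis F (Suc i)). lin_ext (diff F i) f = 0} =
       lin_ext (diff F (Suc i)) ` free_module V (basis F (Suc (Suc i))))"


section \<open>\<open>Tor\<close> and Castelnuovo-Mumford regularity\<close>

text \<open>
  Here \<open>k = R/(V)\<close>, in degree 0, with \<open>R = k[V]\<close> acting through the constant coefficient.
  Hence \<open>F\<^sub>i \<otimes> k\<close> is the \<open>k\<close>-space on \<open>basis F i\<close>, its part of degree \<open>j\<close> is spanned by the basis
  elements of degree \<open>j\<close>, and the matrix of the differential is reduced to its constant
  coefficients.
\<close>

definition tensor_k :: "('v, 'k::field, 'm) free_complex \<Rightarrow> nat \<Rightarrow> int \<Rightarrow> (nat \<Rightarrow>\<^sub>0 'k) set" where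
  "tensor_k F i j = {g. Poly_Mapping.keys g \<subseteq> {b \<in> basis F i. bdeg F i b = j}}"

definition tensor_diff ::
  "('v, 'k::field, 'm) free_complex \<Rightarrow> nat \<Rightarrow> (nat \<Rightarrow>\<^sub>0 'k) \<Rightarrow> (nat \<Rightarrow>\<^sub>0 'k)" where
  "tensor_diff F i = lin_ext (\<lambda>c. Poly_Mapping.map const_coeff (diff F i c))"

definition tensor_cycles :: "('v, 'k::field, 'm) free_complex \<Rightarrow> nat \<Rightarrow> int \<Rightarrow> (nat \<Rightarrow>\<^sub>0 'k) set" where
  "tensor_cycles F i j =
     {g \<in> tensor_k F i j. case i of 0 \<Rightarrow> True | Suc i' \<Rightarrow> tensor_diff F i' g = 0}"

definition tensor_homology ::
  "('v, 'k::field, 'm) free_complex \<Rightarrow> nat \<Rightarrow> int \<Rightarrow> (nat \<Rightarrow>\<^sub>0 'k) set monoid" where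
  "tensor_homology F i j =
     \<lparr>carrier = tensor_cycles F i j, mult = (+), one = 0\<rparr>
       Mod (tensor_diff F i ` tensor_k F (Suc i) j)"

text \<open>
  The additive group of \<open>Tor\<^sub>i(M, k)\<^sub>j\<close>, computed from an arbitrarily chosen
  graded free resolution of \<open>M\<close>.
\<close>

definition Tor_k ::
  "'v set \<Rightarrow> (('v, 'k::field) mpoly, 'm) graded_module \<Rightarrow> nat \<Rightarrow> int \<Rightarrow> (nat \<Rightarrow>\<^sub>0 'k) set monoid" where
  "Tor_k V M = tensor_homology (SOME F. graded_free_resolution V M F)"

text \<open>
  The supremum is a maximum for finitely generated \<open>M \<noteq> 0\<close>;
  the zero module has regularity \<open>-\<infinity>\<close>.
\<close>

definition regularity :: "'v set \<Rightarrow> (('v, 'k::field) mpoly, 'm) graded_module \<Rightarrow> ereal" where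
  "regularity V M =
     Sup {ereal (real_of_int (j - int i)) | i j. \<not> trivial_group (Tor_k V M i j)}"

end

theory Submission
  imports Defs
begin

text \<open>
  Induct on the number of edges of a not necessarily simple hypergraph with a 2-collage
  \<open>\<C>\<close>, building a graded free resolution of \<open>R/I\<close> whose \<open>i\<close>-th term is generated in degrees
  at most \<open>i + w\<close>, where \<open>w\<close> is the weight \<open>\<Sum>F\<in>\<C>. |F| - 1\<close>. Remove an edge \<open>E\<close>, outside \<open>\<C>\<close> if possible,
  let \<open>J\<close> be the ideal of the remaining edges and \<open>m\<close> the monomial of \<open>E\<close>. If \<open>m \<notin> J\<close>, then
  \<open>R/I\<close> is resolved by the mapping cone of multiplication by \<open>m\<close> from \<open>R/(J : m)\<close>, shifted by \<open>|E|\<close>, to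
  \<open>R/J\<close>. The ideal \<open>J : m\<close> belongs to the edges \<open>E' - E\<close>, which have the 2-collage of all \<open>F - E\<close>.
  If \<open>E - {v} \<subseteq> F \<in> \<C>\<close>, passing from \<open>F\<close> to \<open>F - E\<close> lowers the weight by at least \<open>|E| - 1\<close>;
  if \<open>E \<in> \<C>\<close>, dropping it from \<open>\<C>\<close> does. Either way the cone satisfies the same degree bound.

  The resolution defining \<open>Tor\<close> is arbitrary. It is compared with the constructed one through the
  mapping cone over the identity of \<open>R/I\<close>: this is a resolution of \<open>0\<close>, hence contractible, hence
  exact after tensoring with \<open>k\<close>.
\<close>


section \<open>Linear maps between free modules\<close>

abbreviation lookup where "lookup \<equiv> Poly_Mapping.lookup"
abbreviation keys where "keys \<equiv> Poly_Mapping.keys"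
abbreviation single where "single \<equiv> Poly_Mapping.single"

text \<open>This names the summand of \<open>lin_ext\<close>: rewriting with
  \<open>scale_def[symmetric]\<close> turns \<open>lin_ext\<close> into a sum of scalar multiples,
  to which the module laws apply.\<close>

definition scale :: "'r::comm_ring_1 \<Rightarrow> ('b \<Rightarrow>\<^sub>0 'r) \<Rightarrow> ('b \<Rightarrow>\<^sub>0 'r)" where
  "scale r f = Poly_Mapping.map ((*) r) f"

lemma lookup_map_zero: "g 0 = 0 \<Longrightarrow> lookup (Poly_Mapping.map g f) b = g (lookup f b)"
  by (simp add: Poly_Mapping.map.rep_eq when_def)

lemma lookup_scale [simp]: "lookup (scale r f) b = r * lookup f b"
  by (simp add: scale_def lookup_map_zero)

lemma scale_simps [simp]:
  "scale r 0 = 0" "scale 0 f = 0" "scale 1 f = f" "scale r (single b s) = single b (r * s)"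
  by (auto intro!: poly_mapping_eqI simp: lookup_single when_def)

lemma scale_add: "scale r (f + g) = scale r f + scale r g" "scale (r + s) f = scale r f + scale s f"
  by (auto intro!: poly_mapping_eqI simp: lookup_add algebra_simps)

lemma scale_uminus: "scale r (- f) = - scale r f"
  by (auto intro!: poly_mapping_eqI)

lemma scale_scale: "scale r (scale s f) = scale (r * s) f"
  by (auto intro!: poly_mapping_eqI simp: algebra_simps)

lemma scale_sum: "scale r (sum h A) = (\<Sum>x\<in>A. scale r (h x))"
  by (auto intro!: poly_mapping_eqI simp: lookup_sum sum_distrib_left)

text \<open>Families with different supports can be summed over one common index set, which is how
  additivity and all later coefficient comparisons are obtained.\<close>

lemma lin_ext_superset:
  assumes "finite A" "keys f \<subseteq> A"
  shows "lin_ext D f = (\<Sum>c\<in>A. scale (lookup f c) (D c))"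
  unfolding lin_ext_def scale_def[symmetric]
  by (rule sum.mono_neutral_left) (use assms in \<open>auto simp: in_keys_iff\<close>)

lemma lookup_lin_ext: "lookup (lin_ext D f) b = (\<Sum>c\<in>keys f. lookup f c * lookup (D c) b)"
  by (simp add: lin_ext_def scale_def[symmetric] lookup_sum)

lemma lin_ext_zero [simp]: "lin_ext D 0 = 0"
  by (simp add: lin_ext_def)

lemma lin_ext_single [simp]: "lin_ext D (single c r) = scale r (D c)"
  by (subst lin_ext_superset[of "{c}"]) auto

lemma lin_ext_add: "lin_ext D (f + g) = lin_ext D f + lin_ext D g"
proof -
  let ?A = "keys f \<union> keys g"
  have "keys (f + g) \<subseteq> ?A" by (rule keys_add)
  then show ?thesis
    by (simp add: lin_ext_superset[of ?A] lookup_add scale_add sum.distrib)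
qed

lemma keys_scale: "keys (scale r f) \<subseteq> keys f"
  by (auto simp: in_keys_iff)

lemma lin_ext_scale: "lin_ext D (scale r f) = scale r (lin_ext D f)"
  using keys_scale[of r f] by (simp add: lin_ext_superset[of "keys f"] scale_sum scale_scale)

lemma lin_ext_uminus: "lin_ext D (- f) = - lin_ext D f"
proof -
  have "lin_ext D (f + (- f)) = lin_ext D f + lin_ext D (- f)" by (rule lin_ext_add)
  then show ?thesis by (simp add: eq_neg_iff_add_eq_0 add.commute)
qed

lemma lin_ext_diff: "lin_ext D (f - g) = lin_ext D f - lin_ext D g"
  by (metis lin_ext_add lin_ext_uminus add_uminus_conv_diff)

lemma lin_ext_sum: "lin_ext D (sum h A) = (\<Sum>x\<in>A. lin_ext D (h x))"
  by (induction A rule: infinite_finite_induct) (auto simp: lin_ext_add)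

lemma lin_ext_comp: "lin_ext D (lin_ext E f) = lin_ext (\<lambda>c. lin_ext D (E c)) f"
proof -
  have "lin_ext D (lin_ext E f) = (\<Sum>c\<in>keys f. scale (lookup f c) (lin_ext D (E c)))"
    by (subst (2) lin_ext_def) (simp add: scale_def[symmetric] lin_ext_sum lin_ext_scale)
  then show ?thesis by (simp add: lin_ext_def scale_def)
qed

lemma lin_ext_cong: "(\<And>c. c \<in> keys f \<Longrightarrow> D c = E c) \<Longrightarrow> lin_ext D f = lin_ext E f"
  by (simp add: lin_ext_def)

lemma sum_single_lookup: "(\<Sum>m\<in>keys p. single m (lookup p m)) = p"
  by (rule poly_mapping_eqI)
    (auto simp: lookup_sum lookup_single when_def in_keys_iff sum.delta)

lemma lin_ext_single_id: "lin_ext (\<lambda>c. single c 1) f = f"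
  by (simp add: lin_ext_def scale_def[symmetric] sum_single_lookup)

lemma lin_ext_plus: "lin_ext (\<lambda>c. D c + E c) f = lin_ext D f + lin_ext E f"
  by (simp add: lin_ext_def scale_def[symmetric] scale_add sum.distrib)

lemma lin_ext_minus: "lin_ext (\<lambda>c. D c - E c) f = lin_ext D f - lin_ext E f"
  by (simp add: lin_ext_def scale_def[symmetric] scale_add(1)[of _ _ "- _", simplified]
      scale_uminus sum.distrib sum_subtractf)

lemma lin_ext_zero_map [simp]: "lin_ext (\<lambda>c. 0) f = 0"
  by (simp add: lin_ext_def scale_def[symmetric])


section \<open>Homogeneous components\<close>

lemma keys_add_nat: "keys (m + n) = keys m \<union> keys (n :: 'v \<Rightarrow>\<^sub>0 nat)"
  by (auto simp: in_keys_iff lookup_add)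

lemma mon_deg_superset:
  "finite A \<Longrightarrow> keys m \<subseteq> A \<Longrightarrow> mon_deg m = (\<Sum>x\<in>A. lookup m x)"
  unfolding mon_deg_def by (rule sum.mono_neutral_left) (auto simp: in_keys_iff)

lemma mon_deg_add: "mon_deg (m + n) = mon_deg m + mon_deg n"
  by (simp add: mon_deg_superset[of "keys m \<union> keys n"] keys_add_nat lookup_add sum.distrib)

definition hcomp :: "int \<Rightarrow> ('v, 'k::field) mpoly \<Rightarrow> ('v, 'k) mpoly" where
  "hcomp d p = Poly_Mapping.mapp (\<lambda>m c. c when int (mon_deg m) = d) p"

lemma lookup_hcomp: "lookup (hcomp d p) m = (lookup p m when int (mon_deg m) = d)"
  by (auto simp: hcomp_def lookup_mapp when_def in_keys_iff)

lemma hcomp_add: "hcomp d (p + q) = hcomp d p + hcomp d q"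
  by (rule poly_mapping_eqI) (simp add: lookup_hcomp lookup_add when_def)

lemma hcomp_minus: "hcomp d (p - q) = hcomp d p - hcomp d q"
  by (rule poly_mapping_eqI) (simp add: lookup_hcomp lookup_minus when_def)

lemma hcomp_zero [simp]: "hcomp d 0 = 0"
  by (rule poly_mapping_eqI) (simp add: lookup_hcomp)

lemma hcomp_sum: "hcomp d (sum h A) = (\<Sum>x\<in>A. hcomp d (h x))"
  by (induction A rule: infinite_finite_induct) (auto simp: hcomp_add)

lemma keys_hcomp: "keys (hcomp d p) = {m \<in> keys p. int (mon_deg m) = d}"
  by (auto simp: in_keys_iff lookup_hcomp when_def split: if_splits)

lemma homogeneous_hcomp: "homogeneous d (hcomp d p)"
  by (simp add: homogeneous_def keys_hcomp)

lemma hcomp_homogeneous: "homogeneous d p \<Longrightarrow> hcomp d p = p"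
  by (rule poly_mapping_eqI) (auto simp: lookup_hcomp homogeneous_def when_def in_keys_iff)

lemma hcomp_single: "hcomp d (single m a) = (if int (mon_deg m) = d then single m a else 0)"
  by (rule poly_mapping_eqI) (auto simp: lookup_hcomp lookup_single when_def)

text \<open>By bilinearity it is enough to consider two monomials, where degrees add. Homogeneity of
  one factor suffices, so the other may be an arbitrary coefficient.\<close>

lemma hcomp_mult:
  assumes "homogeneous s q"
  shows "hcomp d (p * q) = hcomp (d - s) p * q"
proof -
  have single: "hcomp d (single m a * single n b) = hcomp (d - s) (single m a) * single n b"
    if "n \<in> keys q" for m n :: "'a \<Rightarrow>\<^sub>0 nat" and a b :: 'b
    using assms that by (auto simp: homogeneous_def mult_single hcomp_single mon_deg_add)
  have "hcomp d (single m a * q) = hcomp (d - s) (single m a) * q" for m a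
  proof -
    have "hcomp d (single m a * (\<Sum>n\<in>keys q. single n (lookup q n)))
        = hcomp (d - s) (single m a) * (\<Sum>n\<in>keys q. single n (lookup q n))"
      by (simp add: sum_distrib_left hcomp_sum single)
    then show ?thesis by (simp add: sum_single_lookup)
  qed
  then have "hcomp d ((\<Sum>m\<in>keys p. single m (lookup p m)) * q)
        = hcomp (d - s) (\<Sum>m\<in>keys p. single m (lookup p m)) * q"
    by (simp add: sum_distrib_right hcomp_sum)
  then show ?thesis by (simp add: sum_single_lookup)
qed

text \<open>As fixed points of an additive projection, homogeneous polynomials are closed under
  differences and sums without any inspection of supports.\<close>

lemma homogeneous_iff_hcomp: "homogeneous d p \<longleftrightarrow> hcomp d p = p"
  by (metis hcomp_homogeneous homogeneous_hcomp)

lemma homogeneous_zero [simp]: "homogeneous d 0"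
  by (simp add: homogeneous_def)

lemma homogeneous_one [simp]: "homogeneous 0 1"
  by (simp add: homogeneous_def mon_deg_def)

lemma homogeneous_minus: "homogeneous d p \<Longrightarrow> homogeneous d q \<Longrightarrow> homogeneous d (p - q)"
  by (simp add: homogeneous_iff_hcomp hcomp_minus)

lemma homogeneous_sum: "(\<And>x. x \<in> A \<Longrightarrow> homogeneous d (h x)) \<Longrightarrow> homogeneous d (sum h A)"
  by (simp add: homogeneous_iff_hcomp hcomp_sum)

lemma homogeneous_mult: "homogeneous d p \<Longrightarrow> homogeneous s q \<Longrightarrow> homogeneous (d + s) (p * q)"
  by (simp add: homogeneous_iff_hcomp hcomp_mult homogeneous_hcomp)


section \<open>Graded pieces of free modules\<close>

abbreviation PR :: "'v set \<Rightarrow> ('v, 'k::field) mpoly set" where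
  "PR V \<equiv> carrier (poly_ring V)"

lemma PR_iff: "p \<in> PR V \<longleftrightarrow> (\<forall>m\<in>keys p. keys m \<subseteq> V)"
  by (simp add: poly_ring_def)

lemma PR_zero [simp]: "0 \<in> PR V" and PR_one [simp]: "1 \<in> PR V"
  by (auto simp: PR_iff)

lemma PR_add: "p \<in> PR V \<Longrightarrow> q \<in> PR V \<Longrightarrow> p + q \<in> PR V"
  using keys_add[of p q] by (auto simp: PR_iff)

lemma PR_uminus: "p \<in> PR V \<Longrightarrow> - p \<in> PR V"
  by (auto simp: PR_iff in_keys_iff)

lemma PR_minus: "p \<in> PR V \<Longrightarrow> q \<in> PR V \<Longrightarrow> p - q \<in> PR V"
  by (metis PR_add PR_uminus add_uminus_conv_diff)

lemma PR_mult:
  assumes "p \<in> PR V" "q \<in> PR V"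
  shows "p * q \<in> PR V"
proof -
  have "keys m \<subseteq> V" if "m \<in> keys (p * q)" for m
  proof -
    obtain a b where "m = a + b" "a \<in> keys p" "b \<in> keys q"
      using keys_mult[of p q] \<open>m \<in> keys (p * q)\<close> by auto
    then show ?thesis using assms by (simp add: PR_iff keys_add_nat)
  qed
  then show ?thesis by (simp add: PR_iff)
qed

lemma PR_sum: "(\<And>x. x \<in> A \<Longrightarrow> h x \<in> PR V) \<Longrightarrow> sum h A \<in> PR V"
  by (induction A rule: infinite_finite_induct) (auto simp: PR_add)

lemma PR_hcomp: "p \<in> PR V \<Longrightarrow> hcomp d p \<in> PR V"
  by (auto simp: PR_iff keys_hcomp)

abbreviation FM :: "'v set \<Rightarrow> nat set \<Rightarrow> (nat \<Rightarrow>\<^sub>0 ('v, 'k::field) mpoly) set" where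
  "FM \<equiv> free_module"

lemma FM_iff: "f \<in> FM V B \<longleftrightarrow> keys f \<subseteq> B \<and> (\<forall>b. lookup f b \<in> PR V)"
  by (simp add: free_module_def)

lemma FM_zero [simp]: "0 \<in> FM V B"
  by (simp add: FM_iff)

lemma FM_add: "f \<in> FM V B \<Longrightarrow> g \<in> FM V B \<Longrightarrow> f + g \<in> FM V B"
  using keys_add[of f g] by (auto simp: FM_iff lookup_add PR_add)

lemma FM_uminus: "f \<in> FM V B \<Longrightarrow> - f \<in> FM V B"
  by (auto simp: FM_iff PR_uminus in_keys_iff)

lemma FM_minus: "f \<in> FM V B \<Longrightarrow> g \<in> FM V B \<Longrightarrow> f - g \<in> FM V B"
  by (metis FM_add FM_uminus add_uminus_conv_diff)

lemma FM_scale: "r \<in> PR V \<Longrightarrow> f \<in> FM V B \<Longrightarrow> scale r f \<in> FM V B"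
  using keys_scale[of r f] by (auto simp: FM_iff PR_mult)

lemma FM_sum: "(\<And>x. x \<in> A \<Longrightarrow> h x \<in> FM V B) \<Longrightarrow> sum h A \<in> FM V B"
  by (induction A rule: infinite_finite_induct) (auto simp: FM_add)

lemma FM_single: "b \<in> B \<Longrightarrow> r \<in> PR V \<Longrightarrow> single b r \<in> FM V B"
  by (auto simp: FM_iff lookup_single when_def)

lemma FM_lin_ext:
  assumes "f \<in> FM V B" "\<And>c. c \<in> B \<Longrightarrow> D c \<in> FM V B'"
  shows "lin_ext D f \<in> FM V B'"
  unfolding lin_ext_def scale_def[symmetric]
  by (rule FM_sum, rule FM_scale) (use assms in \<open>auto simp: FM_iff\<close>)

text \<open>This is the degree \<delta> part of the graded free module on \<open>B\<close>. Indices
  outside \<open>B\<close> impose nothing, because zero is homogeneous of every degree.\<close>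

definition piece :: "'v set \<Rightarrow> nat set \<Rightarrow> (nat \<Rightarrow> int) \<Rightarrow> int \<Rightarrow> (nat \<Rightarrow>\<^sub>0 ('v, 'k::field) mpoly) set" where
  "piece V B dg \<delta> = {f \<in> FM V B. \<forall>b. homogeneous (\<delta> - dg b) (lookup f b)}"

lemma piece_FM: "f \<in> piece V B dg \<delta> \<Longrightarrow> f \<in> FM V B"
  by (simp add: piece_def)

lemma piece_zero [simp]: "0 \<in> piece V B dg \<delta>"
  by (simp add: piece_def)

lemma piece_minus: "f \<in> piece V B dg \<delta> \<Longrightarrow> g \<in> piece V B dg \<delta> \<Longrightarrow> f - g \<in> piece V B dg \<delta>"
  by (simp add: piece_def FM_minus lookup_minus homogeneous_minus)

lemma piece_single:
  "b \<in> B \<Longrightarrow> r \<in> PR V \<Longrightarrow> homogeneous s r \<Longrightarrow> \<delta> = dg b + s \<Longrightarrow> single b r \<in> piece V B dg \<delta>"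
  by (auto simp: piece_def FM_single lookup_single when_def)

text \<open>The parameter \<open>s\<close> covers both degree-preserving maps and maps that raise
  degrees, such as lifts of multiplication by a form of degree \<open>s\<close>.\<close>

lemma piece_lin_ext:
  assumes f: "f \<in> piece V B dg \<delta>" and D: "\<And>c. c \<in> B \<Longrightarrow> D c \<in> piece V B' dg' (dg c + s)"
  shows "lin_ext D f \<in> piece V B' dg' (\<delta> + s)"
proof -
  have "homogeneous (\<delta> + s - dg' b) (lookup f c * lookup (D c) b)" if "c \<in> keys f" for b c
  proof -
    have "c \<in> B" using f that by (auto simp: piece_def FM_iff)
    then have "homogeneous ((\<delta> - dg c) + (dg c + s - dg' b)) (lookup f c * lookup (D c) b)"
      by (intro homogeneous_mult) (use f D in \<open>auto simp: piece_def\<close>)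
    then show ?thesis by (simp add: algebra_simps)
  qed
  then show ?thesis
    using f D by (auto simp: piece_def FM_lin_ext lookup_lin_ext intro!: homogeneous_sum)
qed

definition homogeneous_part :: "(nat \<Rightarrow> int) \<Rightarrow> int \<Rightarrow> (nat \<Rightarrow>\<^sub>0 ('v, 'k::field) mpoly) \<Rightarrow> (nat \<Rightarrow>\<^sub>0 ('v, 'k) mpoly)" where
  "homogeneous_part dg \<delta> f = Poly_Mapping.mapp (\<lambda>b. hcomp (\<delta> - dg b)) f"

lemma lookup_homogeneous_part [simp]: "lookup (homogeneous_part dg \<delta> f) b = hcomp (\<delta> - dg b) (lookup f b)"
  by (auto simp: homogeneous_part_def lookup_mapp when_def in_keys_iff)

lemma keys_homogeneous_part: "keys (homogeneous_part dg \<delta> f) \<subseteq> keys f"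
  by (auto simp: in_keys_iff)

lemma homogeneous_part_piece: "f \<in> FM V B \<Longrightarrow> homogeneous_part dg \<delta> f \<in> piece V B dg \<delta>"
  using keys_homogeneous_part[of dg \<delta> f] by (auto simp: piece_def FM_iff PR_hcomp homogeneous_hcomp)

lemma homogeneous_part_id: "f \<in> piece V B dg \<delta> \<Longrightarrow> homogeneous_part dg \<delta> f = f"
  by (rule poly_mapping_eqI) (simp add: piece_def hcomp_homogeneous)

text \<open>A degree-preserving linear map commutes with projection to one degree. This is what
  makes arbitrary preimages homogeneous later on.\<close>

lemma lin_ext_homogeneous_part:
  assumes f: "f \<in> FM V B" and D: "\<And>c. c \<in> B \<Longrightarrow> D c \<in> piece V B' dg' (dg c)"
  shows "lin_ext D (homogeneous_part dg \<delta> f) = homogeneous_part dg' \<delta> (lin_ext D f)"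
proof (rule poly_mapping_eqI)
  fix b
  have "hcomp (\<delta> - dg' b) (lookup f c * lookup (D c) b) = hcomp (\<delta> - dg c) (lookup f c) * lookup (D c) b"
    if "c \<in> keys f" for c
  proof -
    have "c \<in> B" using f that by (auto simp: FM_iff)
    then have "homogeneous (dg c - dg' b) (lookup (D c) b)" using D by (auto simp: piece_def)
    then show ?thesis by (simp add: hcomp_mult)
  qed
  moreover have "lookup (lin_ext D (homogeneous_part dg \<delta> f)) b =
      (\<Sum>c\<in>keys f. hcomp (\<delta> - dg c) (lookup f c) * lookup (D c) b)"
    using keys_homogeneous_part[of dg \<delta> f] by (simp add: lin_ext_superset[of "keys f"] lookup_sum)
  ultimately show "lookup (lin_ext D (homogeneous_part dg \<delta> f)) b = lookup (homogeneous_part dg' \<delta> (lin_ext D f)) b"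
    by (simp add: lookup_lin_ext hcomp_sum)
qed


section \<open>Resolutions of cyclic modules\<close>

text \<open>The augmentation is encoded by polynomials \<open>e b\<close>, read modulo the ideal.\<close>

definition aug_eval :: "(nat \<Rightarrow> ('v, 'k::field) mpoly) \<Rightarrow> (nat \<Rightarrow>\<^sub>0 ('v, 'k) mpoly) \<Rightarrow> ('v, 'k) mpoly" where
  "aug_eval e f = lookup (lin_ext (\<lambda>b. single 0 (e b)) f) (0::nat)"

lemma aug_eval_sum: "aug_eval e f = (\<Sum>b\<in>keys f. lookup f b * e b)"
  by (simp add: aug_eval_def lookup_lin_ext)

lemma aug_eval_zero [simp]: "aug_eval e 0 = 0"
  by (simp add: aug_eval_def)

lemma aug_eval_add: "aug_eval e (f + g) = aug_eval e f + aug_eval e g"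
  by (simp add: aug_eval_def lin_ext_add lookup_add)

lemma aug_eval_minus: "aug_eval e (f - g) = aug_eval e f - aug_eval e g"
  by (simp add: aug_eval_def lin_ext_diff lookup_minus)

lemma aug_eval_zero_map [simp]: "aug_eval (\<lambda>_. 0) f = 0"
  by (simp add: aug_eval_sum)

lemma aug_eval_single [simp]: "aug_eval e (single b r) = r * e b"
  by (simp add: aug_eval_def)

lemma aug_eval_PR: "f \<in> FM V B \<Longrightarrow> (\<And>b. b \<in> B \<Longrightarrow> e b \<in> PR V) \<Longrightarrow> aug_eval e f \<in> PR V"
  by (auto simp: aug_eval_sum FM_iff intro!: PR_sum PR_mult)

lemma aug_eval_lin_ext: "aug_eval e (lin_ext D f) = aug_eval (\<lambda>c. aug_eval e (D c)) f"
  by (simp add: lin_ext_def[of D] scale_def[symmetric] aug_eval_sum[of "\<lambda>c. aug_eval e (D c)"])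
    (simp add: aug_eval_def lin_ext_sum lin_ext_scale lookup_sum)

text \<open>Homogeneous ideals of k[V], phrased on bare polynomials so that the homological algebra
  stays free of ring records; \<open>graded_ideal_ideal\<close> links it to
  \<open>ideal\<close>.\<close>

definition graded_ideal :: "'v set \<Rightarrow> ('v, 'k::field) mpoly set \<Rightarrow> bool" where
  "graded_ideal V J \<longleftrightarrow> J \<subseteq> PR V \<and> 0 \<in> J \<and> (\<forall>p\<in>J. \<forall>q\<in>J. p + q \<in> J) \<and>
     (\<forall>r\<in>PR V. \<forall>p\<in>J. r * p \<in> J) \<and> (\<forall>d. \<forall>p\<in>J. hcomp d p \<in> J)"

lemma graded_idealD:
  assumes "graded_ideal V J"
  shows "p \<in> J \<Longrightarrow> p \<in> PR V" "0 \<in> J" "p \<in> J \<Longrightarrow> q \<in> J \<Longrightarrow> p + q \<in> J"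
    "r \<in> PR V \<Longrightarrow> p \<in> J \<Longrightarrow> r * p \<in> J" "p \<in> J \<Longrightarrow> hcomp d p \<in> J"
    "p \<in> J \<Longrightarrow> - p \<in> J" "p \<in> J \<Longrightarrow> q \<in> J \<Longrightarrow> p - q \<in> J"
proof -
  show "- p \<in> J" if "p \<in> J" for p
    using assms that PR_uminus[OF PR_one, of V]
    unfolding graded_ideal_def by (metis mult_minus_left mult_1)
  then show "p \<in> J \<Longrightarrow> q \<in> J \<Longrightarrow> p - q \<in> J"
    using assms unfolding graded_ideal_def by (metis add_uminus_conv_diff)
qed (use assms in \<open>auto simp: graded_ideal_def\<close>)

text \<open>The kernel of the map leaving the \<open>i\<close>-th term, where the zeroth term is
  left by the augmentation into R/J. Exactness at all stages then becomes a single
  condition.\<close>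

definition cycle ::
  "('v, 'k::field) mpoly set \<Rightarrow> (nat \<Rightarrow> nat \<Rightarrow> (nat \<Rightarrow>\<^sub>0 ('v, 'k) mpoly)) \<Rightarrow> (nat \<Rightarrow> ('v, 'k) mpoly) \<Rightarrow>
     nat \<Rightarrow> (nat \<Rightarrow>\<^sub>0 ('v, 'k) mpoly) \<Rightarrow> bool" where
  "cycle J D e i f = (case i of 0 \<Rightarrow> aug_eval e f \<in> J | Suc i' \<Rightarrow> lin_ext (D i') f = 0)"

lemma cycle_simps [simp]:
  "cycle J D e 0 f \<longleftrightarrow> aug_eval e f \<in> J" "cycle J D e (Suc i) f \<longleftrightarrow> lin_ext (D i) f = 0"
  by (simp_all add: cycle_def)

text \<open>A graded free resolution of R/J with the augmentation replaced by representatives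
  \<open>e b\<close> in R. Surjectivity onto R/J is \<open>aug_surj\<close>; \<open>exact\<close> at
  0 describes the kernel of the augmentation.\<close>

locale poly_res =
  fixes V :: "'v set" and J :: "('v, 'k::field) mpoly set" and B :: "nat \<Rightarrow> nat set"
    and dg :: "nat \<Rightarrow> nat \<Rightarrow> int" and D :: "nat \<Rightarrow> nat \<Rightarrow> (nat \<Rightarrow>\<^sub>0 ('v, 'k) mpoly)"
    and e :: "nat \<Rightarrow> ('v, 'k) mpoly"
  assumes ideal: "graded_ideal V J"
    and aug_PR: "b \<in> B 0 \<Longrightarrow> e b \<in> PR V"
    and aug_hom: "b \<in> B 0 \<Longrightarrow> homogeneous (dg 0 b) (e b)"
    and diff_piece: "c \<in> B (Suc i) \<Longrightarrow> D i c \<in> piece V (B i) (dg i) (dg (Suc i) c)"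
    and aug_surj: "p \<in> PR V \<Longrightarrow> \<exists>f\<in>FM V (B 0). p - aug_eval e f \<in> J"
    and exact: "{f \<in> FM V (B i). cycle J D e i f} = lin_ext (D i) ` FM V (B (Suc i))"
begin

lemma diff_FM: "f \<in> FM V (B (Suc i)) \<Longrightarrow> lin_ext (D i) f \<in> FM V (B i)"
  by (rule FM_lin_ext) (auto dest: diff_piece piece_FM)

lemma cycle_diff: "f \<in> FM V (B (Suc i)) \<Longrightarrow> cycle J D e i (lin_ext (D i) f)"
  using exact[of i] by blast

lemma exactD: "f \<in> FM V (B i) \<Longrightarrow> cycle J D e i f \<Longrightarrow> \<exists>y\<in>FM V (B (Suc i)). lin_ext (D i) y = f"
  by (metis (mono_tags, lifting) exact imageE mem_Collect_eq)

lemma aug_eval_in_PR: "f \<in> FM V (B 0) \<Longrightarrow> aug_eval e f \<in> PR V"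
  by (rule aug_eval_PR) (auto simp: aug_PR)

lemma aug_eval_homogeneous_part:
  assumes "f \<in> FM V (B 0)"
  shows "aug_eval e (homogeneous_part (dg 0) \<delta> f) = hcomp \<delta> (aug_eval e f)"
proof -
  \<comment> \<open>R is viewed as the free module on one basis element of degree 0, so the
    augmentation counts as a degree-preserving linear map.\<close>
  have "single 0 (e b) \<in> piece V {0} (\<lambda>_. 0) (dg 0 b)" if "b \<in> B 0" for b
    by (rule piece_single) (use aug_PR aug_hom that in auto)
  from lin_ext_homogeneous_part[OF assms this] show ?thesis by (simp add: aug_eval_def)
qed

text \<open>Exactness gives some preimage; its part of degree \<delta> has the same image, because
  the differential preserves degrees and \<open>f\<close> already lies in degree \<delta>.\<close>

lemma lift:
  assumes "f \<in> piece V (B i) (dg i) \<delta>" "cycle J D e i f"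
  shows "\<exists>y\<in>piece V (B (Suc i)) (dg (Suc i)) \<delta>. lin_ext (D i) y = f"
proof -
  obtain y where y: "y \<in> FM V (B (Suc i))" "lin_ext (D i) y = f"
    using exactD assms piece_FM by blast
  have "lin_ext (D i) (homogeneous_part (dg (Suc i)) \<delta> y) = f"
    using lin_ext_homogeneous_part[OF y(1) diff_piece] y(2) homogeneous_part_id[OF assms(1)] by simp
  with homogeneous_part_piece[OF y(1)] show ?thesis by blast
qed

lemma lift_aug:
  assumes "p \<in> PR V" "homogeneous \<delta> p"
  shows "\<exists>y\<in>piece V (B 0) (dg 0) \<delta>. p - aug_eval e y \<in> J"
proof -
  obtain y where y: "y \<in> FM V (B 0)" "p - aug_eval e y \<in> J"
    using aug_surj assms by blast
  \<comment> \<open>Since \<open>J\<close> is homogeneous, the congruence may be restricted to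
    degree \<delta>.\<close>
  have "hcomp \<delta> (p - aug_eval e y) \<in> J" using y(2) graded_idealD(5)[OF ideal] by blast
  then have "p - aug_eval e (homogeneous_part (dg 0) \<delta> y) \<in> J"
    using assms(2) by (simp add: hcomp_minus hcomp_homogeneous aug_eval_homogeneous_part y(1))
  with homogeneous_part_piece[OF y(1)] show ?thesis by blast
qed

end


section \<open>Lifting multiplication by a form to a chain map\<close>

text \<open>The condition \<open>colon\<close> says that K = J : \<mu>. That \<mu> K lies in J makes
  lifts of the multiplication R/K \<rightarrow> R/J possible; the converse makes this multiplication
  injective, which the cone needs. It is used with \<mu> the monomial of an edge, and with \<mu> = 1
  to compare two resolutions of the same module.\<close>

locale res_pair = F: poly_res V J BF dF DF eF + G: poly_res V K BG dG DG eG
  for V :: "'v set" and J K :: "('v, 'k::field) mpoly set" and BF dF DF eF BG dG DG eG +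
  fixes \<mu> :: "('v, 'k) mpoly" and s :: int
  assumes mu_PR: "\<mu> \<in> PR V" and mu_hom: "homogeneous s \<mu>"
    and colon: "p \<in> PR V \<Longrightarrow> p \<in> K \<longleftrightarrow> \<mu> * p \<in> J"
begin

text \<open>The last conjunct, that cycles go to cycles, is the invariant from which the next
  component of the chain map is built. The commuting squares relate two components and are kept
  apart in \<open>chain_map_exists\<close>.\<close>

definition lifts :: "nat \<Rightarrow> (nat \<Rightarrow> (nat \<Rightarrow>\<^sub>0 ('v, 'k) mpoly)) \<Rightarrow> bool" where
  "lifts i \<alpha> \<longleftrightarrow> (\<forall>c\<in>BG i. \<alpha> c \<in> piece V (BF i) (dF i) (dG i c + s)) \<and>
     (i = 0 \<longrightarrow> (\<forall>c\<in>BG 0. \<mu> * eG c - aug_eval eF (\<alpha> c) \<in> J)) \<and>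
     (\<forall>g\<in>FM V (BG i). cycle K DG eG i g \<longrightarrow> cycle J DF eF i (lin_ext \<alpha> g))"

lemma lifts_0_aug_eval:
  assumes "\<And>c. c \<in> BG 0 \<Longrightarrow> \<mu> * eG c - aug_eval eF (\<alpha> c) \<in> J" "g \<in> FM V (BG 0)"
  shows "\<mu> * aug_eval eG g - aug_eval eF (lin_ext \<alpha> g) \<in> J"
proof -
  have "(\<Sum>c\<in>A. lookup g c * (\<mu> * eG c - aug_eval eF (\<alpha> c))) \<in> J" if "finite A" "A \<subseteq> keys g" for A
    using that
  proof (induction A)
    case (insert c A)
    then have "lookup g c * (\<mu> * eG c - aug_eval eF (\<alpha> c)) \<in> J"
      using assms by (intro graded_idealD(4)[OF F.ideal]) (auto simp: FM_iff)
    with insert show ?case by (simp add: graded_idealD(3)[OF F.ideal])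
  qed (simp add: graded_idealD(2)[OF F.ideal])
  from this[of "keys g"] show ?thesis
    by (simp add: aug_eval_lin_ext) (simp add: aug_eval_sum sum_distrib_left sum_subtractf algebra_simps)
qed

text \<open>The comparison theorem: images may be chosen freely on the basis of the source, and they
  exist because the target is exact. Choosing homogeneous images makes the chain map homogeneous of
  degree \<open>s\<close>.\<close>

lemma chain_map_exists:
  "\<exists>\<alpha>. \<forall>i. lifts i (\<alpha> i) \<and> (\<forall>c\<in>BG (Suc i). lin_ext (DF i) (\<alpha> (Suc i) c) = lin_ext (\<alpha> i) (DG i c))"
proof (rule dependent_nat_choice)
  have "\<exists>y\<in>piece V (BF 0) (dF 0) (dG 0 c + s). \<mu> * eG c - aug_eval eF y \<in> J" if "c \<in> BG 0" for c
    using that homogeneous_mult[OF mu_hom G.aug_hom[OF that]]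
    by (intro F.lift_aug PR_mult mu_PR G.aug_PR) (auto simp: add.commute)
  then obtain \<alpha> where \<alpha>: "\<And>c. c \<in> BG 0 \<Longrightarrow> \<alpha> c \<in> piece V (BF 0) (dF 0) (dG 0 c + s)"
    "\<And>c. c \<in> BG 0 \<Longrightarrow> \<mu> * eG c - aug_eval eF (\<alpha> c) \<in> J" by metis
  have "aug_eval eF (lin_ext \<alpha> g) \<in> J" if g: "g \<in> FM V (BG 0)" "aug_eval eG g \<in> K" for g
  proof -
    have "\<mu> * aug_eval eG g \<in> J" using colon g G.aug_eval_in_PR by blast
    from graded_idealD(7)[OF F.ideal this lifts_0_aug_eval[OF \<alpha>(2) g(1)]] show ?thesis by simp
  qed
  with \<alpha> show "\<exists>\<alpha>. lifts 0 \<alpha>" unfolding lifts_def by (intro exI[of _ \<alpha>]) auto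
next
  fix \<alpha> i
  assume L: "lifts i \<alpha>"
  have "\<exists>y\<in>piece V (BF (Suc i)) (dF (Suc i)) (dG (Suc i) c + s). lin_ext (DF i) y = lin_ext \<alpha> (DG i c)"
    if c: "c \<in> BG (Suc i)" for c
  proof (rule F.lift)
    show "lin_ext \<alpha> (DG i c) \<in> piece V (BF i) (dF i) (dG (Suc i) c + s)"
      by (rule piece_lin_ext[OF G.diff_piece[OF c]]) (use L in \<open>auto simp: lifts_def\<close>)
    have "cycle K DG eG i (DG i c)"
      using G.cycle_diff[of "single c 1" i] c by (simp add: FM_single)
    then show "cycle J DF eF i (lin_ext \<alpha> (DG i c))"
      using L piece_FM[OF G.diff_piece[OF c]] by (auto simp: lifts_def)
  qed
  then obtain \<alpha>' where \<alpha>':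
    "\<And>c. c \<in> BG (Suc i) \<Longrightarrow> \<alpha>' c \<in> piece V (BF (Suc i)) (dF (Suc i)) (dG (Suc i) c + s)"
    "\<And>c. c \<in> BG (Suc i) \<Longrightarrow> lin_ext (DF i) (\<alpha>' c) = lin_ext \<alpha> (DG i c)" by metis
  \<comment> \<open>The square extends from basis elements by linearity. On a cycle \<open>g\<close>
    its right side vanishes, which is the invariant for \<alpha>'.\<close>
  have "lin_ext (DF i) (lin_ext \<alpha>' g) = lin_ext \<alpha> (lin_ext (DG i) g)" if "g \<in> FM V (BG (Suc i))" for g
    unfolding lin_ext_comp by (rule lin_ext_cong) (use \<alpha>'(2) that in \<open>auto simp: FM_iff\<close>)
  then show "\<exists>\<alpha>'. lifts (Suc i) \<alpha>' \<and> (\<forall>c\<in>BG (Suc i). lin_ext (DF i) (\<alpha>' c) = lin_ext \<alpha> (DG i c))"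
    using \<alpha>' unfolding lifts_def by (intro exI[of _ \<alpha>']) auto
qed

end


section \<open>Mapping cones\<close>

text \<open>The direct sum of two free modules with bases in \<open>\<nat>\<close> has the even and odd numbers as bases
  of its summands.\<close>

definition in0 :: "(nat \<Rightarrow>\<^sub>0 'r::comm_ring_1) \<Rightarrow> (nat \<Rightarrow>\<^sub>0 'r)" where
  "in0 = lin_ext (\<lambda>b. single (2 * b) 1)"
definition in1 :: "(nat \<Rightarrow>\<^sub>0 'r::comm_ring_1) \<Rightarrow> (nat \<Rightarrow>\<^sub>0 'r)" where
  "in1 = lin_ext (\<lambda>b. single (2 * b + 1) 1)"
definition pr0 :: "(nat \<Rightarrow>\<^sub>0 'r::comm_ring_1) \<Rightarrow> (nat \<Rightarrow>\<^sub>0 'r)" where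
  "pr0 = lin_ext (\<lambda>n. if even n then single (n div 2) 1 else 0)"
definition pr1 :: "(nat \<Rightarrow>\<^sub>0 'r::comm_ring_1) \<Rightarrow> (nat \<Rightarrow>\<^sub>0 'r)" where
  "pr1 = lin_ext (\<lambda>n. if odd n then single (n div 2) 1 else 0)"

lemma pr_in [simp]: "pr0 (in0 f) = f" "pr1 (in0 f) = 0" "pr0 (in1 f) = 0" "pr1 (in1 f) = f"
  by (simp_all add: in0_def in1_def pr0_def pr1_def lin_ext_comp lin_ext_single_id)

lemma in_pr: "in0 (pr0 f) + in1 (pr1 f) = f"
proof -
  have "in0 (pr0 f) + in1 (pr1 f) = lin_ext (\<lambda>n. single n 1) f"
    unfolding in0_def in1_def pr0_def pr1_def lin_ext_comp lin_ext_plus[symmetric]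
    by (rule lin_ext_cong) (auto elim: oddE)
  then show ?thesis by (simp add: lin_ext_single_id)
qed

lemma in_pr_linear [simp]:
  "in0 0 = 0" "in1 0 = 0" "pr0 0 = 0" "pr1 0 = 0"
  "in0 (f + g) = in0 f + in0 g" "in1 (f + g) = in1 f + in1 g"
  "in0 (f - g) = in0 f - in0 g" "in1 (f - g) = in1 f - in1 g"
  "pr0 (f + g) = pr0 f + pr0 g" "pr1 (f + g) = pr1 f + pr1 g"
  "pr0 (f - g) = pr0 f - pr0 g" "pr1 (f - g) = pr1 f - pr1 g"
  "in0 (- f) = - in0 f" "in1 (- f) = - in1 f"
  "in0 (single b r) = single (2 * b) r" "in1 (single b r) = single (2 * b + 1) r"
  by (simp_all add: in0_def in1_def pr0_def pr1_def lin_ext_add lin_ext_diff lin_ext_uminus)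

lemma in0_eq: "in0 f = lin_ext (\<lambda>b. single (2 * b) 1) f"
  and in1_eq: "in1 f = lin_ext (\<lambda>b. single (2 * b + 1) 1) f"
  by (simp_all add: in0_def in1_def)

lemma in0_lin_ext: "in0 (lin_ext D f) = lin_ext (\<lambda>c. in0 (D c)) f"
  by (simp add: in0_def lin_ext_comp)

lemma in1_lin_ext: "in1 (lin_ext D f) = lin_ext (\<lambda>c. in1 (D c)) f"
  by (simp add: in1_def lin_ext_comp)

text \<open>The \<open>i\<close>-th term is the direct sum of F_i and G_(i-1). The test
  \<open>i \<noteq> 0\<close> matters: truncated subtraction would otherwise put a copy of G_0 into
  the zeroth term.\<close>

definition cone_basis :: "(nat \<Rightarrow> nat set) \<Rightarrow> (nat \<Rightarrow> nat set) \<Rightarrow> nat \<Rightarrow> nat set" where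
  "cone_basis BF BG i = {n. if even n then n div 2 \<in> BF i else i \<noteq> 0 \<and> n div 2 \<in> BG (i - 1)}"

definition cone_deg :: "(nat \<Rightarrow> nat \<Rightarrow> int) \<Rightarrow> (nat \<Rightarrow> nat \<Rightarrow> int) \<Rightarrow> int \<Rightarrow> nat \<Rightarrow> nat \<Rightarrow> int" where
  "cone_deg dF dG s i n = (if even n then dF i (n div 2) else dG (i - 1) (n div 2) + s)"

text \<open>On a pair (x, y) this is (d x + \<alpha> y, - d y). Index \<open>i\<close> denotes the
  map out of term i + 1, so odd generators come from G_i, and for i = 0 their boundary has no G
  part.\<close>

definition cone_diff where
  "cone_diff DF DG \<alpha> i n =
     (if even n then in0 (DF i (n div 2))
      else in0 (\<alpha> i (n div 2)) - (if i = 0 then 0 else in1 (DG (i - 1) (n div 2))))"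

definition cone_aug :: "(nat \<Rightarrow> 'r::zero) \<Rightarrow> nat \<Rightarrow> 'r" where
  "cone_aug eF n = (if even n then eF (n div 2) else 0)"

lemma lin_ext_cone_diff:
  "lin_ext (cone_diff DF DG \<alpha> i) f =
     in0 (lin_ext (DF i) (pr0 f) + lin_ext (\<alpha> i) (pr1 f))
     - (if i = 0 then 0 else in1 (lin_ext (DG (i - 1)) (pr1 f)))"
proof -
  have 0: "lin_ext (cone_diff DF DG \<alpha> i) (in0 x) = in0 (lin_ext (DF i) x)" for x
    by (simp add: in0_eq[of x] lin_ext_comp in0_lin_ext cone_diff_def)
  have 1: "lin_ext (cone_diff DF DG \<alpha> i) (in1 y) =
      in0 (lin_ext (\<alpha> i) y) - (if i = 0 then 0 else in1 (lin_ext (DG (i - 1)) y))" for y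
    by (simp add: in1_eq[of y] lin_ext_comp in0_lin_ext in1_lin_ext cone_diff_def lin_ext_minus)
  have "lin_ext (cone_diff DF DG \<alpha> i) (in0 (pr0 f) + in1 (pr1 f)) =
      in0 (lin_ext (DF i) (pr0 f) + lin_ext (\<alpha> i) (pr1 f))
      - (if i = 0 then 0 else in1 (lin_ext (DG (i - 1)) (pr1 f)))"
    by (simp only: lin_ext_add 0 1) (simp add: algebra_simps)
  then show ?thesis by (simp add: in_pr)
qed

lemma aug_eval_cone_aug: "aug_eval (cone_aug eF) f = aug_eval eF (pr0 f)"
proof -
  have "aug_eval (cone_aug eF) f = aug_eval (cone_aug eF) (in0 (pr0 f)) + aug_eval (cone_aug eF) (in1 (pr1 f))"
    by (metis aug_eval_add in_pr)
  moreover have "aug_eval (cone_aug eF) (in0 x) = aug_eval eF x" for x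
    by (simp add: in0_def aug_eval_lin_ext cone_aug_def)
  moreover have "aug_eval (cone_aug eF) (in1 y) = 0" for y
    by (simp add: in1_def aug_eval_lin_ext cone_aug_def)
  ultimately show ?thesis by simp
qed

lemma in0_FM: "x \<in> FM V (BF i) \<Longrightarrow> in0 x \<in> FM V (cone_basis BF BG i)"
  unfolding in0_def by (rule FM_lin_ext) (auto simp: cone_basis_def intro!: FM_single)

lemma in1_FM: "y \<in> FM V (BG i) \<Longrightarrow> in1 y \<in> FM V (cone_basis BF BG (Suc i))"
  unfolding in1_def by (rule FM_lin_ext) (auto simp: cone_basis_def intro!: FM_single)

lemma pr0_FM: "f \<in> FM V (cone_basis BF BG i) \<Longrightarrow> pr0 f \<in> FM V (BF i)"
  unfolding pr0_def by (rule FM_lin_ext) (auto simp: cone_basis_def intro!: FM_single)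

lemma pr1_FM: "f \<in> FM V (cone_basis BF BG (Suc i)) \<Longrightarrow> pr1 f \<in> FM V (BG i)"
  unfolding pr1_def by (rule FM_lin_ext) (auto simp: cone_basis_def intro!: FM_single)

lemma pr1_FM_0: "f \<in> FM V (cone_basis BF BG 0) \<Longrightarrow> pr1 f = 0"
proof -
  assume f: "f \<in> FM V (cone_basis BF BG 0)"
  have "pr1 f = lin_ext (\<lambda>_. 0) f"
    unfolding pr1_def by (rule lin_ext_cong) (use f in \<open>auto simp: FM_iff cone_basis_def\<close>)
  then show ?thesis by simp
qed

lemma in0_piece:
  assumes "x \<in> piece V (BF i) (dF i) \<delta>"
  shows "in0 x \<in> piece V (cone_basis BF BG i) (cone_deg dF dG s i) \<delta>"
proof -
  have "in0 x \<in> piece V (cone_basis BF BG i) (cone_deg dF dG s i) (\<delta> + 0)"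
    unfolding in0_def
    by (rule piece_lin_ext[OF assms], rule piece_single[where s = 0]) (auto simp: cone_basis_def cone_deg_def)
  then show ?thesis by simp
qed

lemma in1_piece:
  assumes "y \<in> piece V (BG i) (dG i) \<delta>"
  shows "in1 y \<in> piece V (cone_basis BF BG (Suc i)) (cone_deg dF dG s (Suc i)) (\<delta> + s)"
  unfolding in1_def
  by (rule piece_lin_ext[OF assms], rule piece_single[where s = 0]) (auto simp: cone_basis_def cone_deg_def)

context res_pair
begin

text \<open>Here J' = J + (\<mu>), and the exact sequence 0 \<rightarrow> R/(J : \<mu>)
  \<rightarrow> R/J \<rightarrow> R/J' \<rightarrow> 0, with the first term shifted by
  \<open>s\<close>, explains why the cone resolves R/J'. The proof is the corresponding element
  chase.\<close>

lemma cone: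
  assumes lifts: "\<And>i. lifts i (\<alpha> i)"
    and chain: "\<And>i c. c \<in> BG (Suc i) \<Longrightarrow> lin_ext (DF i) (\<alpha> (Suc i) c) = lin_ext (\<alpha> i) (DG i c)"
    and J': "graded_ideal V J'" "\<And>p. p \<in> J' \<longleftrightarrow> p \<in> PR V \<and> (\<exists>r\<in>PR V. p - \<mu> * r \<in> J)"
  shows "poly_res V J' (cone_basis BF BG) (cone_deg dF dG s) (cone_diff DF DG \<alpha>) (cone_aug eF)"
proof
  let ?B = "cone_basis BF BG" and ?dg = "cone_deg dF dG s" and ?D = "cone_diff DF DG \<alpha>" and ?e = "cone_aug eF"
  have \<alpha>_gp: "\<And>i c. c \<in> BG i \<Longrightarrow> \<alpha> i c \<in> piece V (BF i) (dF i) (dG i c + s)"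
    using lifts by (auto simp: lifts_def)
  have \<alpha>_FM: "lin_ext (\<alpha> i) g \<in> FM V (BF i)" if "g \<in> FM V (BG i)" for i g
    by (rule FM_lin_ext[OF that]) (rule piece_FM[OF \<alpha>_gp])
  have \<alpha>_chain: "lin_ext (DF i) (lin_ext (\<alpha> (Suc i)) g) = lin_ext (\<alpha> i) (lin_ext (DG i) g)"
    if "g \<in> FM V (BG (Suc i))" for i g
    unfolding lin_ext_comp by (rule lin_ext_cong) (use chain that in \<open>auto simp: FM_iff\<close>)
  have \<alpha>_eps: "\<mu> * aug_eval eG g - aug_eval eF (lin_ext (\<alpha> 0) g) \<in> J" if "g \<in> FM V (BG 0)" for g
    by (rule lifts_0_aug_eval) (use lifts[of 0] that in \<open>auto simp: lifts_def\<close>)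
  note Ji = graded_idealD[OF F.ideal]
  show "graded_ideal V J'" by (rule J')
  show "?e b \<in> PR V" "homogeneous (?dg 0 b) (?e b)" if "b \<in> ?B 0" for b
    using that F.aug_PR F.aug_hom by (auto simp: cone_basis_def cone_deg_def cone_aug_def)
  show "?D i c \<in> piece V (?B i) (?dg i) (?dg (Suc i) c)" if c: "c \<in> ?B (Suc i)" for c i
  proof (cases "even c")
    case True
    then show ?thesis
      using c in0_piece[where BF = BF and dF = dF and i = i, OF F.diff_piece] by (auto simp: cone_basis_def cone_deg_def cone_diff_def)
  next
    case False
    then have "c div 2 \<in> BG i" and dg: "?dg (Suc i) c = dG i (c div 2) + s"
      using c by (auto simp: cone_basis_def cone_deg_def)
    then have 0: "in0 (\<alpha> i (c div 2)) \<in> piece V (?B i) (?dg i) (?dg (Suc i) c)"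
      using in0_piece[where BF = BF and dF = dF and i = i, OF \<alpha>_gp] by simp
    show ?thesis
    proof (cases i)
      case (Suc i')
      then have "in1 (DG i' (c div 2)) \<in> piece V (?B i) (?dg i) (?dg (Suc i) c)"
        using in1_piece[where BG = BG and dG = dG and i = i', OF G.diff_piece] \<open>c div 2 \<in> BG i\<close> dg by simp
      with 0 show ?thesis using False Suc by (simp add: cone_diff_def piece_minus)
    qed (use False 0 in \<open>simp add: cone_diff_def\<close>)
  qed
  show "\<exists>f\<in>FM V (?B 0). p - aug_eval ?e f \<in> J'" if p: "p \<in> PR V" for p
  proof -
    obtain f where f: "f \<in> FM V (BF 0)" "p - aug_eval eF f \<in> J" using F.aug_surj[OF p] by blast
    then have "p - aug_eval ?e (in0 f) \<in> J'"
      by (auto simp: aug_eval_cone_aug J'(2) intro!: bexI[of _ 0] dest: Ji(1))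
    with in0_FM[where BF = BF and i = 0, OF f(1)] show ?thesis by blast
  qed
  show "{f \<in> FM V (?B i). cycle J' ?D ?e i f} = lin_ext (?D i) ` FM V (?B (Suc i))" for i
  proof (intro equalityI subsetI)
    fix f assume "f \<in> lin_ext (?D i) ` FM V (?B (Suc i))"
    then obtain h where h: "h \<in> FM V (?B (Suc i))" and f: "f = lin_ext (?D i) h" by blast
    define x where "x = pr0 h"
    define y where "y = pr1 h"
    have x: "x \<in> FM V (BF (Suc i))" and y: "y \<in> FM V (BG i)"
      using h pr0_FM pr1_FM by (auto simp: x_def y_def)
    have f': "f = in0 (lin_ext (DF i) x + lin_ext (\<alpha> i) y)
        - (if i = 0 then 0 else in1 (lin_ext (DG (i - 1)) y))"
      by (simp add: f lin_ext_cone_diff x_def y_def)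
    have "in0 (lin_ext (DF i) x + lin_ext (\<alpha> i) y) \<in> FM V (?B i)"
      by (intro in0_FM FM_add F.diff_FM x \<alpha>_FM y)
    moreover have "(if i = 0 then 0 else in1 (lin_ext (DG (i - 1)) y)) \<in> FM V (?B i)"
      using y by (cases i) (auto intro!: in1_FM G.diff_FM)
    ultimately have "f \<in> FM V (?B i)" unfolding f' by (rule FM_minus)
    moreover have "cycle J' ?D ?e i f"
    proof (cases i)
      case 0
      have "aug_eval eF (lin_ext (DF 0) x) \<in> J" using F.cycle_diff[of x 0] x 0 by simp
      from Ji(7)[OF this \<alpha>_eps[of y]]
      have "aug_eval eF (lin_ext (DF 0) x) + aug_eval eF (lin_ext (\<alpha> 0) y) - \<mu> * aug_eval eG y \<in> J"
        using y 0 by (simp add: algebra_simps)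
      moreover have "aug_eval eF (lin_ext (DF 0) x) + aug_eval eF (lin_ext (\<alpha> 0) y) \<in> PR V"
        using F.diff_FM[of x 0] \<alpha>_FM[of y 0] x y 0 by (intro PR_add F.aug_eval_in_PR) auto
      ultimately have "aug_eval eF (lin_ext (DF 0) x) + aug_eval eF (lin_ext (\<alpha> 0) y) \<in> J'"
        using G.aug_eval_in_PR y 0 unfolding J'(2) by blast
      then show ?thesis using 0 by (simp add: aug_eval_cone_aug f' aug_eval_add)
    next
      case (Suc i')
      have "lin_ext (DF i') (lin_ext (DF i) x) = 0" using F.cycle_diff[of x i] x Suc by simp
      moreover have "lin_ext (DF i') (lin_ext (\<alpha> i) y) = lin_ext (\<alpha> i') (lin_ext (DG i') y)"
        using \<alpha>_chain y Suc by blast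
      moreover have "i' \<noteq> 0 \<Longrightarrow> lin_ext (DG (i' - 1)) (lin_ext (DG i') y) = 0"
        using G.cycle_diff[of y i'] y Suc by (cases i') auto
      ultimately show ?thesis
        by (auto simp: Suc f' lin_ext_cone_diff lin_ext_add lin_ext_uminus)
    qed
    ultimately show "f \<in> {f \<in> FM V (?B i). cycle J' ?D ?e i f}" by blast
  next
    fix f assume "f \<in> {f \<in> FM V (?B i). cycle J' ?D ?e i f}"
    then have f: "f \<in> FM V (?B i)" and cycle: "cycle J' ?D ?e i f" by auto
    define x where "x = pr0 f"
    have x: "x \<in> FM V (BF i)" using f pr0_FM by (auto simp: x_def)
    \<comment> \<open>It remains to solve for the two coordinates of \<open>f\<close> separately;
      the sign in the last equation is that of - d on the G part.\<close>
    have preim: "f \<in> lin_ext (?D i) ` FM V (?B (Suc i))"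
      if "x' \<in> FM V (BF (Suc i))" "y' \<in> FM V (BG i)" "x = lin_ext (DF i) x' + lin_ext (\<alpha> i) y'"
        "pr1 f = - (if i = 0 then 0 else lin_ext (DG (i - 1)) y')" for x' y'
    proof
      show "in0 x' + in1 y' \<in> FM V (?B (Suc i))"
        by (intro FM_add in0_FM in1_FM that)
      have "f = in0 x + in1 (pr1 f)" by (simp add: x_def in_pr)
      then show "f = lin_ext (?D i) (in0 x' + in1 y')"
        using that(3,4) by (simp add: lin_ext_cone_diff)
    qed
    show "f \<in> lin_ext (?D i) ` FM V (?B (Suc i))"
    proof (cases i)
      \<comment> \<open>Modulo \<open>J\<close> the augmentation of \<open>x\<close> is \<mu> r. A
        \<open>g\<close> over \<open>r\<close> gives the correction \<alpha> g, after which
        \<open>x\<close> augments into \<open>J\<close> and exactness of F applies.\<close>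
      case 0
      then have "aug_eval eF x \<in> J'" using cycle by (simp add: aug_eval_cone_aug x_def)
      then obtain r where r: "r \<in> PR V" "aug_eval eF x - \<mu> * r \<in> J" using J'(2) by blast
      obtain g where g: "g \<in> FM V (BG 0)" "r - aug_eval eG g \<in> K" using G.aug_surj[OF r(1)] by blast
      have "\<mu> * (r - aug_eval eG g) \<in> J"
        using g r colon G.aug_eval_in_PR PR_minus by blast
      from Ji(3)[OF Ji(3)[OF r(2) this] \<alpha>_eps[OF g(1)]]
      have "aug_eval eF (x - lin_ext (\<alpha> 0) g) \<in> J" by (simp add: aug_eval_minus algebra_simps)
      then obtain x' where "x' \<in> FM V (BF (Suc 0))" "lin_ext (DF 0) x' = x - lin_ext (\<alpha> 0) g"
        using F.exactD[of "x - lin_ext (\<alpha> 0) g" 0] x g(1) 0 \<alpha>_FM[OF g(1)] by (auto simp: FM_minus)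
      then show ?thesis
        using preim[of x' g] g(1) 0 pr1_FM_0[of f V BF BG] f by auto
    next
      case (Suc i')
      define y where "y = pr1 f"
      have y: "y \<in> FM V (BG i')" using f Suc pr1_FM by (auto simp: y_def)
      have "in0 (lin_ext (DF i') x + lin_ext (\<alpha> i') y)
          - (if i' = 0 then 0 else in1 (lin_ext (DG (i' - 1)) y)) = 0" (is "?l = 0")
        using cycle by (simp add: Suc lin_ext_cone_diff x_def y_def)
      then have l: "pr0 ?l = 0" "pr1 ?l = 0" by simp_all
      have dx: "lin_ext (DF i') x + lin_ext (\<alpha> i') y = 0" using l(1) by (simp split: if_splits)
      have dy: "lin_ext (DG (i' - 1)) y = 0" if "i' \<noteq> 0"
        using l(2) that by simp
      \<comment> \<open>At i' = 0 this is injectivity of \<mu> on R/K: from \<alpha> y = - d x it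
        follows that \<mu> times the augmentation of \<open>y\<close> lies in \<open>J\<close>, and
        \<open>colon\<close> puts the augmentation itself into \<open>K\<close>.\<close>
      have "cycle K DG eG i' y"
      proof (cases i')
        case 0
        have "aug_eval eF (lin_ext (DF 0) x) \<in> J" using F.cycle_diff[of x 0] x Suc 0 by simp
        moreover have "lin_ext (\<alpha> 0) y = - lin_ext (DF 0) x"
          using dx 0 by (simp add: eq_neg_iff_add_eq_0 add.commute)
        then have "aug_eval eF (lin_ext (\<alpha> 0) y) = - aug_eval eF (lin_ext (DF 0) x)"
          by (metis aug_eval_minus aug_eval_zero diff_0)
        ultimately have "aug_eval eF (lin_ext (\<alpha> 0) y) \<in> J" using Ji(6) by simp
        with \<alpha>_eps[of y] y 0 have "\<mu> * aug_eval eG y \<in> J" using Ji(3) by fastforce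
        then show ?thesis using colon G.aug_eval_in_PR y 0 by simp
      qed (use dy in auto)
      then obtain g where g: "g \<in> FM V (BG i)" "lin_ext (DG i') g = y"
        using G.exactD y Suc by blast
      have "lin_ext (DF i') (x + lin_ext (\<alpha> i) g) = 0"
        using dx g(2) \<alpha>_chain[of g i'] g(1) Suc by (simp add: lin_ext_add)
      then obtain x' where x': "x' \<in> FM V (BF (Suc i))" "lin_ext (DF i) x' = x + lin_ext (\<alpha> i) g"
        using F.exactD[of "x + lin_ext (\<alpha> i) g" i] x g(1) Suc \<alpha>_FM[of g i] by (auto simp: FM_add)
      \<comment> \<open>The preimage carries - g, to match the sign of the cone
        differential.\<close>
      show ?thesis
        by (rule preim[of x' "- g"])
          (use x' g Suc in \<open>auto simp: FM_uminus lin_ext_uminus y_def\<close>)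
    qed
  qed
qed

end


section \<open>Reduction to constant coefficients\<close>

lemma const_coeff_zero [simp]: "const_coeff 0 = 0"
  by (simp add: const_coeff_def)

lemma const_coeff_add: "const_coeff (p + q) = const_coeff p + const_coeff q"
  by (simp add: const_coeff_def lookup_add)

lemma const_coeff_sum: "const_coeff (sum h A) = (\<Sum>x\<in>A. const_coeff (h x))"
  by (simp add: const_coeff_def lookup_sum)

lemma const_coeff_single: "const_coeff (single m a) = (if m = 0 then a else 0)"
  by (simp add: const_coeff_def lookup_single when_def)

lemma monomial_add_eq_0: "m + n = 0 \<longleftrightarrow> m = 0 \<and> n = (0 :: 'v \<Rightarrow>\<^sub>0 nat)"
  by (metis Un_empty keys_add_nat keys_eq_empty)

text \<open>A product of monomials is 1 only if both factors are. Taking constant coefficients is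
  thus the ring homomorphism R \<rightarrow> k, and \<open>reduce\<close> is the tensor product with
  k.\<close>

lemma const_coeff_mult: "const_coeff (p * q) = const_coeff p * const_coeff q"
proof -
  have "const_coeff (single m a * q) = const_coeff (single m a) * const_coeff q" for m a
  proof -
    have "const_coeff (single m a * (\<Sum>n\<in>keys q. single n (lookup q n)))
        = const_coeff (single m a) * const_coeff (\<Sum>n\<in>keys q. single n (lookup q n))"
      by (auto simp: sum_distrib_left const_coeff_sum mult_single const_coeff_single monomial_add_eq_0
          intro!: sum.cong)
    then show ?thesis by (simp add: sum_single_lookup)
  qed
  then have "const_coeff ((\<Sum>m\<in>keys p. single m (lookup p m)) * q)
        = const_coeff (\<Sum>m\<in>keys p. single m (lookup p m)) * const_coeff q"
    by (simp add: sum_distrib_right const_coeff_sum)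
  then show ?thesis by (simp add: sum_single_lookup)
qed

text \<open>Consequently a reduced homogeneous matrix only connects basis elements of equal
  degree.\<close>

lemma homogeneous_const_coeff: "homogeneous d p \<Longrightarrow> const_coeff p \<noteq> 0 \<Longrightarrow> d = 0"
  unfolding homogeneous_def const_coeff_def
  by (metis in_keys_iff keys_zero mon_deg_def of_nat_0 sum.empty)

abbreviation reduce :: "(nat \<Rightarrow>\<^sub>0 ('v, 'k::field) mpoly) \<Rightarrow> (nat \<Rightarrow>\<^sub>0 'k)" where
  "reduce \<equiv> Poly_Mapping.map const_coeff"

lemma lookup_reduce [simp]: "lookup (reduce f) b = const_coeff (lookup f b)"
  by (simp add: lookup_map_zero)

lemma keys_reduce: "keys (reduce f) \<subseteq> keys f"
  by (auto simp: in_keys_iff)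

lemma reduce_zero [simp]: "reduce 0 = 0"
  by (rule poly_mapping_eqI) simp

lemma reduce_add: "reduce (f + g) = reduce f + reduce g"
  by (rule poly_mapping_eqI) (simp add: lookup_add const_coeff_add)

lemma reduce_lin_ext: "reduce (lin_ext D f) = lin_ext (\<lambda>c. reduce (D c)) (reduce f)"
  using keys_reduce[of f]
  by (intro poly_mapping_eqI)
    (simp add: lin_ext_superset[of "keys f"] lookup_sum const_coeff_sum const_coeff_mult)

lemma reduce_in0: "reduce (in0 f) = in0 (reduce f)"
  by (simp add: in0_eq reduce_lin_ext)
    (rule lin_ext_cong, auto intro!: poly_mapping_eqI simp: lookup_single when_def const_coeff_def)

text \<open>A section of \<open>reduce\<close>: an identity between linear maps over R descends to k
  by evaluating it on constants and reducing.\<close>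

definition const_emb :: "(nat \<Rightarrow>\<^sub>0 'k::field) \<Rightarrow> (nat \<Rightarrow>\<^sub>0 ('v, 'k) mpoly)" where
  "const_emb z = Poly_Mapping.map (single 0) z"

lemma reduce_const_emb: "reduce (const_emb z) = z"
  by (rule poly_mapping_eqI) (simp add: const_emb_def lookup_map_zero const_coeff_def)

lemma const_emb_FM: "keys z \<subseteq> B \<Longrightarrow> const_emb z \<in> FM V B"
  by (auto simp: const_emb_def FM_iff in_keys_iff lookup_map_zero PR_iff subset_iff) (metis single_zero)

text \<open>Together with \<open>reduced_diff\<close> this restates \<open>tensor_k\<close> and
  \<open>tensor_diff\<close> for a complex given by its separate components, the form in which cones
  are built.\<close>

definition reduced_piece :: "(nat \<Rightarrow> nat set) \<Rightarrow> (nat \<Rightarrow> nat \<Rightarrow> int) \<Rightarrow> nat \<Rightarrow> int \<Rightarrow> (nat \<Rightarrow>\<^sub>0 'k::field) set" where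
  "reduced_piece B dg i j = {z. keys z \<subseteq> {b \<in> B i. dg i b = j}}"

definition reduced_diff :: "(nat \<Rightarrow> nat \<Rightarrow> (nat \<Rightarrow>\<^sub>0 ('v, 'k::field) mpoly)) \<Rightarrow> nat \<Rightarrow> (nat \<Rightarrow>\<^sub>0 'k) \<Rightarrow> (nat \<Rightarrow>\<^sub>0 'k)" where
  "reduced_diff D i = lin_ext (\<lambda>c. reduce (D i c))"

lemma keys_lin_ext: "keys (lin_ext D f) \<subseteq> (\<Union>c\<in>keys f. keys (D c))"
proof -
  have "keys (lin_ext D f) \<subseteq> (\<Union>c\<in>keys f. keys (scale (lookup f c) (D c)))"
    unfolding lin_ext_def scale_def[symmetric] by (rule keys_sum)
  also have "\<dots> \<subseteq> (\<Union>c\<in>keys f. keys (D c))"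
    by (rule UN_mono) (auto dest: subsetD[OF keys_scale])
  finally show ?thesis .
qed

lemma keys_reduce_piece:
  assumes "f \<in> piece V (B i) (dg i) \<delta>"
  shows "keys (reduce f) \<subseteq> {b \<in> B i. dg i b = \<delta>}"
proof
  fix b assume b: "b \<in> keys (reduce f)"
  then have "\<delta> - dg i b = 0"
    using assms homogeneous_const_coeff[of "\<delta> - dg i b" "lookup f b"] by (auto simp: in_keys_iff piece_def)
  moreover have "b \<in> B i" using b keys_reduce[of f] assms by (auto simp: piece_def FM_iff)
  ultimately show "b \<in> {b \<in> B i. dg i b = \<delta>}" by simp
qed

lemma reduced_piece_lin_ext:
  assumes "z \<in> reduced_piece B dg i j" "\<And>c. c \<in> B i \<Longrightarrow> D c \<in> piece V (B' i') (dg' i') (dg i c)"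
  shows "lin_ext (\<lambda>c. reduce (D c)) z \<in> reduced_piece B' dg' i' j"
proof -
  have "keys (reduce (D c)) \<subseteq> {b \<in> B' i'. dg' i' b = j}" if "c \<in> keys z" for c
    using keys_reduce_piece[where B = B' and i = i' and dg = dg', OF assms(2)[of c]] that assms(1)
    by (auto simp: reduced_piece_def)
  then have "(\<Union>c\<in>keys z. keys (reduce (D c))) \<subseteq> {b \<in> B' i'. dg' i' b = j}" by (rule UN_least)
  with keys_lin_ext[of "\<lambda>c. reduce (D c)" z] show ?thesis
    unfolding reduced_piece_def mem_Collect_eq by (rule subset_trans)
qed

context poly_res
begin

lemma reduced_diff_reduced_piece: "z \<in> reduced_piece B dg (Suc i) j \<Longrightarrow> reduced_diff D i z \<in> reduced_piece B dg i j"
  unfolding reduced_diff_def by (rule reduced_piece_lin_ext) (auto intro: diff_piece)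

lemma reduced_diff_reduced_diff:
  assumes "z \<in> reduced_piece B dg (Suc (Suc i)) j"
  shows "reduced_diff D i (reduced_diff D (Suc i) z) = 0"
proof -
  have "lin_ext (D i) (lin_ext (D (Suc i)) (const_emb z)) = 0"
    using cycle_diff[OF const_emb_FM, of z "Suc i"] assms by (auto simp: reduced_piece_def)
  then have "reduce (lin_ext (D i) (lin_ext (D (Suc i)) (const_emb z))) = 0" by simp
  then show ?thesis by (simp add: reduce_lin_ext reduced_diff_def reduce_const_emb)
qed

end

text \<open>The defining property of a contracting homotopy is split into its restriction to cycles,
  which carries the recursion, and the full identity.\<close>

lemma (in poly_res) contraction_exists:
  assumes "J = PR V"
  shows "\<exists>h. \<forall>i. ((\<forall>c\<in>B i. h i c \<in> piece V (B (Suc i)) (dg (Suc i)) (dg i c)) \<and>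
      (\<forall>f\<in>FM V (B i). cycle J D e i f \<longrightarrow> lin_ext (D i) (lin_ext (h i) f) = f)) \<and>
    (\<forall>f\<in>FM V (B (Suc i)). lin_ext (D (Suc i)) (lin_ext (h (Suc i)) f)
       + lin_ext (h i) (lin_ext (D i) f) = f)"
proof (rule dependent_nat_choice)
  \<comment> \<open>As \<open>J\<close> is the whole ring, everything in the zeroth term is a cycle,
    so each basis element is a boundary.\<close>
  have "\<exists>y\<in>piece V (B (Suc 0)) (dg (Suc 0)) (dg 0 c). lin_ext (D 0) y = single c 1" if "c \<in> B 0" for c
    by (rule lift) (use that aug_PR assms in \<open>auto intro: piece_single[where s = 0]\<close>)
  then obtain h where h: "\<And>c. c \<in> B 0 \<Longrightarrow> h c \<in> piece V (B (Suc 0)) (dg (Suc 0)) (dg 0 c)"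
    "\<And>c. c \<in> B 0 \<Longrightarrow> lin_ext (D 0) (h c) = single c 1" by metis
  have "lin_ext (D 0) (lin_ext h f) = f" if "f \<in> FM V (B 0)" for f
  proof -
    have "lin_ext (D 0) (lin_ext h f) = lin_ext (\<lambda>c. single c 1) f"
      unfolding lin_ext_comp by (rule lin_ext_cong) (use h that in \<open>auto simp: FM_iff\<close>)
    then show ?thesis by (simp add: lin_ext_single_id)
  qed
  with h show "\<exists>h. (\<forall>c\<in>B 0. h c \<in> piece V (B (Suc 0)) (dg (Suc 0)) (dg 0 c)) \<and>
      (\<forall>f\<in>FM V (B 0). cycle J D e 0 f \<longrightarrow> lin_ext (D 0) (lin_ext h f) = f)"
    by (intro exI[of _ h]) auto
next
  fix h i
  assume "(\<forall>c\<in>B i. h c \<in> piece V (B (Suc i)) (dg (Suc i)) (dg i c)) \<and>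
      (\<forall>f\<in>FM V (B i). cycle J D e i f \<longrightarrow> lin_ext (D i) (lin_ext h f) = f)"
  then have hgp: "\<And>c. c \<in> B i \<Longrightarrow> h c \<in> piece V (B (Suc i)) (dg (Suc i)) (dg i c)"
    and hcyc: "\<And>f. f \<in> FM V (B i) \<Longrightarrow> cycle J D e i f \<Longrightarrow> lin_ext (D i) (lin_ext h f) = f"
    by auto
  \<comment> \<open>The element c - h d c is a cycle because d h d c = d c; a preimage of it is the
    next value of the homotopy.\<close>
  have "\<exists>y\<in>piece V (B (Suc (Suc i))) (dg (Suc (Suc i))) (dg (Suc i) c).
      lin_ext (D (Suc i)) y = single c 1 - lin_ext h (D i c)" if c: "c \<in> B (Suc i)" for c
  proof (rule lift)
    have "lin_ext h (D i c) \<in> piece V (B (Suc i)) (dg (Suc i)) (dg (Suc i) c + 0)"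
      by (rule piece_lin_ext[OF diff_piece[OF c]]) (use hgp in auto)
    then show "single c 1 - lin_ext h (D i c) \<in> piece V (B (Suc i)) (dg (Suc i)) (dg (Suc i) c)"
      using c by (auto intro!: piece_minus piece_single[where s = 0])
    have "cycle J D e i (D i c)"
      using cycle_diff[of "single c 1" i] c by (simp add: FM_single)
    then have "lin_ext (D i) (lin_ext h (D i c)) = D i c"
      using hcyc piece_FM[OF diff_piece[OF c]] by blast
    then show "cycle J D e (Suc i) (single c 1 - lin_ext h (D i c))"
      by (simp add: lin_ext_diff)
  qed
  then obtain h' where h':
    "\<And>c. c \<in> B (Suc i) \<Longrightarrow> h' c \<in> piece V (B (Suc (Suc i))) (dg (Suc (Suc i))) (dg (Suc i) c)"
    "\<And>c. c \<in> B (Suc i) \<Longrightarrow> lin_ext (D (Suc i)) (h' c) = single c 1 - lin_ext h (D i c)" by metis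
  have "lin_ext (D (Suc i)) (lin_ext h' f) + lin_ext h (lin_ext (D i) f) = f"
    if "f \<in> FM V (B (Suc i))" for f
  proof -
    have "lin_ext (D (Suc i)) (lin_ext h' f) = lin_ext (\<lambda>c. single c 1 - lin_ext h (D i c)) f"
      unfolding lin_ext_comp by (rule lin_ext_cong) (use h' that in \<open>auto simp: FM_iff\<close>)
    then show ?thesis by (simp add: lin_ext_minus lin_ext_single_id lin_ext_comp)
  qed
  moreover from this have "lin_ext (D (Suc i)) (lin_ext h' f) = f"
    if "f \<in> FM V (B (Suc i))" "lin_ext (D i) f = 0" for f
    using that by (metis add.right_neutral lin_ext_zero)
  ultimately show "\<exists>h'. ((\<forall>c\<in>B (Suc i). h' c \<in> piece V (B (Suc (Suc i))) (dg (Suc (Suc i))) (dg (Suc i) c)) \<and>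
      (\<forall>f\<in>FM V (B (Suc i)). cycle J D e (Suc i) f \<longrightarrow> lin_ext (D (Suc i)) (lin_ext h' f) = f)) \<and>
    (\<forall>f\<in>FM V (B (Suc i)). lin_ext (D (Suc i)) (lin_ext h' f) + lin_ext h (lin_ext (D i) f) = f)"
    using h'(1) by (intro exI[of _ h']) simp
qed

definition reduced_cycle where
  "reduced_cycle D i z = (case i of 0 \<Rightarrow> True | Suc i' \<Rightarrow> reduced_diff D i' z = 0)"

text \<open>Exactness alone need not survive tensoring with k, but a linear contraction does:
  reducing it gives a contraction of the reduced complex, whose value at \<open>z\<close> is the
  required preimage.\<close>

lemma (in poly_res) unit_ideal_tensor_exact:
  assumes "J = PR V" and z: "z \<in> reduced_piece B dg i j" "reduced_cycle D i z"
  shows "\<exists>y\<in>reduced_piece B dg (Suc i) j. reduced_diff D i y = z"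
proof -
  obtain h where h: "\<And>i c. c \<in> B i \<Longrightarrow> h i c \<in> piece V (B (Suc i)) (dg (Suc i)) (dg i c)"
    "\<And>i f. f \<in> FM V (B i) \<Longrightarrow> cycle J D e i f \<Longrightarrow> lin_ext (D i) (lin_ext (h i) f) = f"
    "\<And>i f. f \<in> FM V (B (Suc i)) \<Longrightarrow>
        lin_ext (D (Suc i)) (lin_ext (h (Suc i)) f) + lin_ext (h i) (lin_ext (D i) f) = f"
    using contraction_exists[OF assms(1)] by metis
  define y where "y = lin_ext (\<lambda>c. reduce (h i c)) z"
  have "y \<in> reduced_piece B dg (Suc i) j"
    unfolding y_def using z(1) by (rule reduced_piece_lin_ext) (rule h)
  moreover have fm: "const_emb z \<in> FM V (B i)" using z(1) by (auto simp: reduced_piece_def intro: const_emb_FM)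
  have "reduced_diff D i y = z"
  proof (cases i)
    case 0
    have "reduce (lin_ext (D 0) (lin_ext (h 0) (const_emb z))) = z"
      using h(2)[of "const_emb z" 0] fm 0 aug_eval_in_PR assms(1) by (simp add: reduce_const_emb)
    then show ?thesis by (simp add: 0 y_def reduced_diff_def reduce_lin_ext reduce_const_emb)
  next
    case (Suc i')
    have "reduce (lin_ext (D i) (lin_ext (h i) (const_emb z)) + lin_ext (h i') (lin_ext (D i') (const_emb z))) = z"
      using h(3)[of "const_emb z" i'] fm Suc by (simp add: reduce_const_emb)
    moreover have "reduce (lin_ext (D i') (const_emb z)) = 0"
      using z(2) Suc by (simp add: reduced_cycle_def reduce_lin_ext reduce_const_emb reduced_diff_def)
    ultimately show ?thesis
      by (simp add: y_def reduced_diff_def reduce_add reduce_lin_ext reduce_const_emb)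
  qed
  ultimately show ?thesis by blast
qed

text \<open>The mapping cone of a lift of the identity of the resolved module resolves \<open>0\<close>.\<close>

lemma tensor_exact_where_other_resolution_vanishes:
  fixes J :: "('v, 'k::field) mpoly set"
  assumes F: "poly_res V J BF dF DF eF" and G: "poly_res V J BG dG DG eG"
    and vanish: "\<And>b. b \<in> BG i \<Longrightarrow> dG i b \<noteq> j"
    and z: "z \<in> reduced_piece BF dF i j" "reduced_cycle DF i z"
  shows "\<exists>y\<in>reduced_piece BF dF (Suc i) j. reduced_diff DF i y = z"
proof -
  interpret res_pair V J J BF dF DF eF BG dG DG eG 1 0
    by (intro res_pair.intro res_pair_axioms.intro F G) auto
  obtain \<alpha> where \<alpha>: "\<And>i. lifts i (\<alpha> i)"
    "\<And>i c. c \<in> BG (Suc i) \<Longrightarrow> lin_ext (DF i) (\<alpha> (Suc i) c) = lin_ext (\<alpha> i) (DG i c)"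
    using chain_map_exists by auto
  have PR_ideal: "graded_ideal V (PR V)"
    by (auto simp: graded_ideal_def PR_add PR_mult PR_hcomp)
  have "p \<in> PR V \<longleftrightarrow> p \<in> PR V \<and> (\<exists>r\<in>PR V. p - 1 * r \<in> J)" for p
    using graded_idealD(2)[OF F.ideal] by (auto intro: bexI[of _ p])
  then interpret T: poly_res V "PR V" "cone_basis BF BG" "cone_deg dF dG 0" "cone_diff DF DG \<alpha>" "cone_aug eF"
    using cone[OF \<alpha> PR_ideal] by blast
  have reduced_diff_in0: "reduced_diff (cone_diff DF DG \<alpha>) i (in0 x) = in0 (reduced_diff DF i x)" for i and x :: "nat \<Rightarrow>\<^sub>0 'k"
    unfolding reduced_diff_def in0_eq[of x] lin_ext_comp in0_lin_ext
    by (rule lin_ext_cong) (simp add: cone_diff_def reduce_in0)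
  have "in0 z \<in> reduced_piece (cone_basis BF BG) (cone_deg dF dG 0) i j"
    using z(1) keys_lin_ext[of "\<lambda>b. single (2 * b) 1" z]
    by (auto simp: reduced_piece_def cone_basis_def cone_deg_def in0_eq dest!: subsetD)
  moreover have "reduced_cycle (cone_diff DF DG \<alpha>) i (in0 z)"
    using z(2) by (cases i) (auto simp: reduced_cycle_def reduced_diff_in0)
  ultimately obtain y where y: "y \<in> reduced_piece (cone_basis BF BG) (cone_deg dF dG 0) (Suc i) j"
    "reduced_diff (cone_diff DF DG \<alpha>) i y = in0 z"
    using T.unit_ideal_tensor_exact by blast
  \<comment> \<open>In term i + 1 the odd generators come from G_i, which by \<open>vanish\<close>
    has none of degree \<open>j\<close>. So \<open>y\<close> lies in the F summand, where the cone
    differential is that of F.\<close>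
  have "even c" if "c \<in> keys y" for c
  proof -
    have "c \<in> cone_basis BF BG (Suc i)" "cone_deg dF dG 0 (Suc i) c = j"
      using y(1) that unfolding reduced_piece_def by blast+
    then show ?thesis
      using vanish[of "c div 2"] by (auto simp: cone_basis_def cone_deg_def split: if_splits)
  qed
  then have "pr1 y = lin_ext (\<lambda>_. 0) y"
    unfolding pr1_def by (intro lin_ext_cong) auto
  then have y0: "y = in0 (pr0 y)" using in_pr[of y] by simp
  then have "in0 (reduced_diff DF i (pr0 y)) = in0 z" using y(2) reduced_diff_in0 by metis
  then have "reduced_diff DF i (pr0 y) = z" by (metis pr_in(1))
  moreover have "b \<in> BF (Suc i) \<and> dF (Suc i) b = j" if "b \<in> keys (pr0 y)" for b
  proof -
    have "b \<in> (\<Union>n\<in>keys y. keys (if even n then single (n div 2) (1 :: 'k) else 0))"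
      using keys_lin_ext that unfolding pr0_def by (rule subsetD)
    then obtain c where c: "c \<in> keys y" "even c" "b = c div 2"
      by (auto split: if_splits)
    then have "c \<in> cone_basis BF BG (Suc i)" "cone_deg dF dG 0 (Suc i) c = j"
      using y(1) unfolding reduced_piece_def by blast+
    with c show ?thesis by (auto simp: cone_basis_def cone_deg_def)
  qed
  then have "pr0 y \<in> reduced_piece BF dF (Suc i) j" by (auto simp: reduced_piece_def)
  ultimately show ?thesis by blast
qed


section \<open>Squarefree monomial ideals\<close>

text \<open>A squarefree monomial divides a monomial exactly if its variables lie in the support, so
  the ideal generated by the monomials of \<E> is described by supports alone. The description also
  makes sense for the families E' - E arising from colon ideals.\<close>

definition monomial_ideal :: "'v set \<Rightarrow> 'v set set \<Rightarrow> ('v, 'k::field) mpoly set" where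
  "monomial_ideal V \<E> = {p \<in> PR V. \<forall>m\<in>keys p. \<exists>E\<in>\<E>. E \<subseteq> keys m}"

definition sqf :: "'v set \<Rightarrow> 'v \<Rightarrow>\<^sub>0 nat" where
  "sqf E = (\<Sum>x\<in>E. single x 1)"

definition sqf_mono :: "'v set \<Rightarrow> ('v, 'k::field) mpoly" where
  "sqf_mono E = single (sqf E) 1"

lemma lookup_sqf: "finite E \<Longrightarrow> lookup (sqf E) x = (if x \<in> E then 1 else 0)"
  by (simp add: sqf_def lookup_sum lookup_single when_def sum.delta)

lemma keys_sqf: "finite E \<Longrightarrow> keys (sqf E) = E"
  by (auto simp: in_keys_iff lookup_sqf split: if_splits)

lemma mon_deg_sqf: "finite E \<Longrightarrow> mon_deg (sqf E) = card E"
  by (simp add: mon_deg_def keys_sqf lookup_sqf)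

lemma prod_var: "finite E \<Longrightarrow> (\<Prod>x\<in>E. var x) = sqf_mono E"
  by (induction E rule: finite_induct)
    (auto simp: sqf_def sqf_mono_def var_def mult_single single_one[symmetric] simp del: single_one)

lemma sqf_divides: "finite E \<Longrightarrow> E \<subseteq> keys m \<Longrightarrow> m = sqf E + (m - sqf E)"
  by (rule poly_mapping_eqI) (auto simp: lookup_add lookup_minus lookup_sqf in_keys_iff subset_iff)

lemma keys_monomial_diff: "keys (m - n) \<subseteq> keys (m :: 'v \<Rightarrow>\<^sub>0 nat)"
  by (auto simp: in_keys_iff lookup_minus)

lemma PR_monomial:
  assumes "p \<in> PR V" "m \<in> keys p"
  shows "single m a \<in> PR V" "single (m - n) a \<in> PR V"
proof -
  have "keys m \<subseteq> V" using assms by (simp add: PR_iff)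
  then show "single m a \<in> PR V" "single (m - n) a \<in> PR V"
    using keys_monomial_diff[of m n] by (auto simp: PR_iff)
qed

lemma sqf_mono_PR: "finite E \<Longrightarrow> E \<subseteq> V \<Longrightarrow> sqf_mono E \<in> PR V"
  by (simp add: PR_iff sqf_mono_def keys_sqf)

lemma sqf_mono_hom: "finite E \<Longrightarrow> homogeneous (int (card E)) (sqf_mono E)"
  by (simp add: homogeneous_def sqf_mono_def mon_deg_sqf)

text \<open>Multiplication by a monomial translates exponents injectively, so no terms
  cancel.\<close>

lemma keys_mult_single: "keys (single n 1 * p) = (+) n ` keys (p :: ('v, 'k::field) mpoly)"
proof -
  have eq: "single n 1 * p = (\<Sum>m\<in>keys p. single (n + m) (lookup p m))"
    by (subst (1) sum_single_lookup[of p, symmetric]) (simp add: sum_distrib_left mult_single)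
  have "lookup (single n 1 * p) (n + m) = lookup p m" for m
    unfolding eq by (auto simp: lookup_sum lookup_single when_def in_keys_iff sum.delta)
  moreover have "keys (single n 1 * p) \<subseteq> (+) n ` keys p"
    using keys_mult[of "single n 1" p] by auto
  ultimately show ?thesis by (auto simp: in_keys_iff)
qed

lemma monomial_ideal_graded_ideal: "graded_ideal V (monomial_ideal V \<E>)"
  unfolding graded_ideal_def
proof (intro conjI ballI allI)
  show "p + q \<in> monomial_ideal V \<E>" if "p \<in> monomial_ideal V \<E>" "q \<in> monomial_ideal V \<E>" for p q :: "('a, 'b) mpoly"
    using that keys_add[of p q] by (auto simp: monomial_ideal_def PR_add)
  show "r * p \<in> monomial_ideal V \<E>" if "r \<in> PR V" "p \<in> monomial_ideal V \<E>" for r p :: "('a, 'b) mpoly"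
  proof -
    have "\<exists>E\<in>\<E>. E \<subseteq> keys m" if m: "m \<in> keys (r * p)" for m
    proof -
      obtain a b where m: "m = a + b" "b \<in> keys p" using keys_mult[of r p] m by auto
      then obtain E where "E \<in> \<E>" "E \<subseteq> keys b" using \<open>p \<in> monomial_ideal V \<E>\<close> by (auto simp: monomial_ideal_def)
      then show ?thesis using m(1) by (auto simp: keys_add_nat intro!: bexI[of _ E])
    qed
    with that show ?thesis by (simp add: monomial_ideal_def PR_mult)
  qed
qed (auto simp: monomial_ideal_def PR_hcomp keys_hcomp)

text \<open>Multiplying by the monomial of \<open>E\<close> adds \<open>E\<close> to every support,
  and E' lies in the union of \<open>E\<close> and a support exactly if E' - E lies in the
  support.\<close>

lemma monomial_ideal_colon:
  assumes "finite E" "E \<subseteq> V" "p \<in> PR V"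
  shows "p \<in> monomial_ideal V ((\<lambda>E'. E' - E) ` \<E>) \<longleftrightarrow> sqf_mono E * p \<in> monomial_ideal V \<E>"
proof -
  have "sqf_mono E * p \<in> PR V" by (intro PR_mult sqf_mono_PR assms)
  then show ?thesis
    using assms by (simp add: monomial_ideal_def sqf_mono_def keys_mult_single keys_add_nat keys_sqf
        Diff_subset_conv)
qed

text \<open>The terms of \<open>p\<close> divisible by the monomial of \<open>E\<close> are
  collected, and their quotient is the witness \<open>r\<close>; each remaining term is covered by
  another edge.\<close>

lemma monomial_ideal_insert:
  assumes "finite E" "E \<subseteq> V"
  shows "p \<in> monomial_ideal V (insert E \<E>) \<longleftrightarrow> p \<in> PR V \<and> (\<exists>r\<in>PR V. p - sqf_mono E * r \<in> monomial_ideal V \<E>)"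
proof safe
  assume p: "p \<in> monomial_ideal V (insert E \<E>)"
  then show "p \<in> PR V" by (simp add: monomial_ideal_def)
  let ?A = "{m \<in> keys p. E \<subseteq> keys m}"
  define r where "r = (\<Sum>m\<in>?A. single (m - sqf E) (lookup p m))"
  have "r \<in> PR V"
    unfolding r_def by (rule PR_sum) (simp add: PR_monomial[OF \<open>p \<in> PR V\<close>])
  moreover have "sqf_mono E * r = (\<Sum>m\<in>?A. single m (lookup p m))"
    unfolding r_def sum_distrib_left
    by (rule sum.cong) (simp_all add: sqf_mono_def mult_single sqf_divides[OF assms(1), symmetric])
  then have "p - sqf_mono E * r = (\<Sum>m\<in>keys p - ?A. single m (lookup p m))"
    by (subst (1) sum_single_lookup[of p, symmetric]) (simp add: sum_diff[symmetric])
  moreover have "(\<Sum>m\<in>keys p - ?A. single m (lookup p m)) \<in> monomial_ideal V \<E>"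
  proof -
    have "keys (\<Sum>m\<in>keys p - ?A. single m (lookup p m)) \<subseteq> keys p - ?A"
      by (rule order_trans[OF keys_sum]) auto
    then have "\<exists>E'\<in>\<E>. E' \<subseteq> keys m" if "m \<in> keys (\<Sum>m\<in>keys p - ?A. single m (lookup p m))" for m
      using that p unfolding monomial_ideal_def by blast
    moreover have "(\<Sum>m\<in>keys p - ?A. single m (lookup p m)) \<in> PR V"
      by (rule PR_sum) (simp add: PR_monomial[OF \<open>p \<in> PR V\<close>])
    ultimately show ?thesis by (simp add: monomial_ideal_def)
  qed
  ultimately show "\<exists>r\<in>PR V. p - sqf_mono E * r \<in> monomial_ideal V \<E>" by metis
next
  fix r assume p: "p \<in> PR V" and r: "r \<in> PR V" "p - sqf_mono E * r \<in> monomial_ideal V \<E>"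
  have "sqf_mono E * r \<in> monomial_ideal V (insert E \<E>)"
    using r(1) PR_mult[OF sqf_mono_PR[OF assms] r(1)]
    by (simp add: monomial_ideal_def sqf_mono_def keys_mult_single keys_add_nat keys_sqf assms)
  moreover have "p - sqf_mono E * r \<in> monomial_ideal V (insert E \<E>)"
    using r(2) by (auto simp: monomial_ideal_def)
  ultimately have "p - sqf_mono E * r + sqf_mono E * r \<in> monomial_ideal V (insert E \<E>)"
    using monomial_ideal_graded_ideal unfolding graded_ideal_def by blast
  then show "p \<in> monomial_ideal V (insert E \<E>)" by simp
qed

section \<open>The edge ideal as a monomial ideal\<close>

lemma poly_ring_simps:
  "mult (poly_ring V) = (*)" "one (poly_ring V) = 1" "zero (poly_ring V) = 0"
  "add (poly_ring V) = (+)"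
  by (simp_all add: poly_ring_def)

lemma poly_ring_cring: "cring (poly_ring V :: ('v, 'k::field) mpoly ring)"
proof (intro cringI abelian_groupI comm_monoidI)
  fix x :: "('v, 'k) mpoly" assume "x \<in> PR V"
  then show "\<exists>y\<in>PR V. y \<oplus>\<^bsub>poly_ring V\<^esub> x = \<zero>\<^bsub>poly_ring V\<^esub>"
    by (intro bexI[of _ "- x"]) (auto simp: poly_ring_simps PR_uminus)
qed (auto simp: poly_ring_simps PR_add PR_mult algebra_simps)

lemma graded_ideal_ideal:
  assumes "graded_ideal V J"
  shows "ideal J (poly_ring V)"
proof -
  interpret cring "poly_ring V" by (rule poly_ring_cring)
  note J = graded_idealD[OF assms]
  have J_r: "p * r \<in> J" if "p \<in> J" "r \<in> PR V" for p r
    using J(4) that by (subst mult.commute)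
  show ?thesis
  proof (rule idealI)
    show "subgroup J (add_monoid (poly_ring V))"
    proof (rule add.subgroupI)
      show "\<ominus>\<^bsub>poly_ring V\<^esub> a \<in> J" if "a \<in> J" for a
      proof -
        have "\<ominus>\<^bsub>poly_ring V\<^esub> a = - a"
          by (rule add.inv_equality) (use J(1)[OF that] in \<open>auto simp: poly_ring_simps PR_uminus\<close>)
        then show ?thesis using J(6) that by simp
      qed
    qed (use J in \<open>auto simp: poly_ring_simps\<close>)
  qed (use J(4) J_r ring_axioms in \<open>auto simp: poly_ring_simps\<close>)
qed

text \<open>One inclusion is minimality of the generated ideal; for the other, each term of a
  polynomial on the right is a multiple of a generator.\<close>

lemma edge_ideal_eq_monomial_ideal:
  assumes "hypergraph V \<E>"
  shows "edge_ideal V \<E> = (monomial_ideal V \<E> :: ('v, 'k::field) mpoly set)"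
proof -
  interpret cring "poly_ring V :: ('v, 'k) mpoly ring" by (rule poly_ring_cring)
  have fin: "finite E" "E \<subseteq> V" if "E \<in> \<E>" for E
    using assms that by (auto simp: hypergraph_def intro: finite_subset)
  let ?G = "(\<lambda>E. \<Prod>x\<in>E. var x :: ('v, 'k) mpoly) ` \<E>"
  have G: "?G = sqf_mono ` \<E>" by (rule image_cong) (auto simp: prod_var fin)
  have G_monomial_ideal: "?G \<subseteq> monomial_ideal V \<E>"
    unfolding G by (auto simp: monomial_ideal_def sqf_mono_PR fin) (auto simp: sqf_mono_def keys_sqf fin)
  have G_PR: "?G \<subseteq> PR V" using G_monomial_ideal by (auto simp: monomial_ideal_def)
  show ?thesis
  proof
    show "edge_ideal V \<E> \<subseteq> (monomial_ideal V \<E> :: ('v, 'k) mpoly set)"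
      unfolding edge_ideal_def by (rule genideal_minimal[OF graded_ideal_ideal[OF monomial_ideal_graded_ideal] G_monomial_ideal])
  next
    interpret I: ideal "edge_ideal V \<E>" "poly_ring V :: ('v, 'k) mpoly ring"
      unfolding edge_ideal_def by (rule genideal_ideal[OF G_PR])
    have gen: "(sqf_mono E :: ('v, 'k) mpoly) \<in> edge_ideal V \<E>" if "E \<in> \<E>" for E
      using genideal_self[OF G_PR] that unfolding edge_ideal_def G by blast
    show "monomial_ideal V \<E> \<subseteq> (edge_ideal V \<E> :: ('v, 'k) mpoly set)"
    proof
      fix p :: "('v, 'k) mpoly" assume p: "p \<in> monomial_ideal V \<E>"
      have summand: "single m (lookup p m) \<in> edge_ideal V \<E>" if m: "m \<in> keys p" for m
      proof -
        obtain E where E: "E \<in> \<E>" "E \<subseteq> keys m" using p m by (auto simp: monomial_ideal_def)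
        have "single (m - sqf E) (lookup p m) \<in> PR V"
          using p m by (intro PR_monomial) (auto simp: monomial_ideal_def)
        from I.I_r_closed[OF gen[OF E(1)] this]
        show ?thesis
          by (simp add: poly_ring_simps sqf_mono_def mult_single
              sqf_divides[OF fin(1)[OF E(1)] E(2), symmetric])
      qed
      have "(\<Sum>m\<in>A. single m (lookup p m)) \<in> edge_ideal V \<E>" if "finite A" "A \<subseteq> keys p" for A
        using that
      proof (induction A)
        case empty
        then show ?case using I.zero_closed by (simp add: poly_ring_simps)
      next
        case (insert m A)
        then show ?case using I.a_closed summand by (simp add: poly_ring_simps)
      qed
      from this[of "keys p"] show "p \<in> edge_ideal V \<E>" by (simp add: sum_single_lookup)
    qed
  qed
qed


section \<open>Resolutions of squarefree monomial ideals with a 2-collage\<close>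

text \<open>The number \<open>w\<close> bounds degree minus homological index over all generators.
  The \<open>itself\<close> argument fixes the field, which \<open>V\<close> and \<E> do not
  determine.\<close>

definition has_res :: "'k::field itself \<Rightarrow> 'v set \<Rightarrow> 'v set set \<Rightarrow> int \<Rightarrow> bool" where
  "has_res _ V \<E> w \<longleftrightarrow> (\<exists>B dg D e. poly_res V (monomial_ideal V \<E> :: ('v, 'k) mpoly set) B dg D e \<and>
     (\<forall>i. \<forall>b\<in>B i. dg i b \<le> int i + w))"

lemma has_res_mono: "has_res k V \<E> w \<Longrightarrow> w \<le> w' \<Longrightarrow> has_res k V \<E> w'"
  unfolding has_res_def by (meson add_left_mono order_trans)

text \<open>The base of the induction: R is free over itself on one generator of degree 0.\<close>

lemma has_res_empty:
  fixes V :: "'v set"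
  shows "has_res (k :: 'k::field itself) V {} 0"
proof -
  define D :: "nat \<Rightarrow> nat \<Rightarrow> (nat \<Rightarrow>\<^sub>0 ('v, 'k) mpoly)" where "D = (\<lambda>_ _. 0)"
  let ?B = "\<lambda>i :: nat. if i = 0 then {0 :: nat} else {}"
  have monomial_ideal: "monomial_ideal V {} = {0 :: ('v, 'k) mpoly}"
    by (auto simp: monomial_ideal_def)
  have FM0: "f = single 0 (lookup f 0)" if "f \<in> FM V {0}" for f :: "nat \<Rightarrow>\<^sub>0 ('v, 'k) mpoly"
  proof (rule poly_mapping_eqI)
    show "lookup f b = lookup (single 0 (lookup f 0)) b" for b
      using that by (cases "b = 0") (auto simp: FM_iff lookup_single in_keys_iff)
  qed
  have FM_empty: "FM V {} = {0 :: nat \<Rightarrow>\<^sub>0 ('v, 'k) mpoly}"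
    by (auto simp: FM_iff)
  have "poly_res V (monomial_ideal V {}) ?B (\<lambda>_ _. 0) D (\<lambda>_. 1)"
  proof
    show "\<exists>f\<in>FM V (?B 0). p - aug_eval (\<lambda>_. 1) f \<in> monomial_ideal V {}" if "p \<in> PR V" for p :: "('v, 'k) mpoly"
      using that by (intro bexI[of _ "single 0 p"]) (auto simp: monomial_ideal FM_single)
    show "{f \<in> FM V (?B i). cycle (monomial_ideal V {}) D (\<lambda>_. 1) i f} = lin_ext (D i) ` FM V (?B (Suc i))" for i
    proof (cases i)
      case 0
      have "f = 0" if "f \<in> FM V {0}" "aug_eval (\<lambda>_. 1) f = 0" for f :: "nat \<Rightarrow>\<^sub>0 ('v, 'k) mpoly"
        using FM0[OF that(1)] that(2) by (metis aug_eval_single mult_1_right single_zero)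
      with 0 show ?thesis by (auto simp: FM_empty monomial_ideal)
    qed (auto simp: FM_empty)
  qed (auto simp: monomial_ideal_graded_ideal)
  then show ?thesis unfolding has_res_def by (intro exI) auto
qed

text \<open>In the cone, G_(i-1) shifted by |E| has degrees at most (i - 1) + w' + |E|, which the
  numerical hypothesis bounds by i + w.\<close>

lemma has_res_insert:
  assumes "finite E" "E \<subseteq> V"
    and "has_res k V \<E> w" "has_res k V ((\<lambda>E'. E' - E) ` \<E>) w'"
    and "w' + int (card E) - 1 \<le> w"
  shows "has_res k V (insert E \<E>) w"
proof -
  obtain BF dF DF and eF :: "nat \<Rightarrow> ('a, 'b) mpoly"
    where F: "poly_res V (monomial_ideal V \<E>) BF dF DF eF" and wF: "\<And>i b. b \<in> BF i \<Longrightarrow> dF i b \<le> int i + w"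
    using assms(3) unfolding has_res_def by metis
  obtain BG dG DG and eG :: "nat \<Rightarrow> ('a, 'b) mpoly"
    where G: "poly_res V (monomial_ideal V ((\<lambda>E'. E' - E) ` \<E>)) BG dG DG eG"
      and wG: "\<And>i b. b \<in> BG i \<Longrightarrow> dG i b \<le> int i + w'"
    using assms(4) unfolding has_res_def by metis
  interpret res_pair V "monomial_ideal V \<E>" "monomial_ideal V ((\<lambda>E'. E' - E) ` \<E>)" BF dF DF eF BG dG DG eG "sqf_mono E"
    "int (card E)"
    by (intro res_pair.intro res_pair_axioms.intro F G sqf_mono_PR sqf_mono_hom monomial_ideal_colon assms)
  obtain \<alpha> where \<alpha>: "\<And>i. lifts i (\<alpha> i)"
    "\<And>i c. c \<in> BG (Suc i) \<Longrightarrow> lin_ext (DF i) (\<alpha> (Suc i) c) = lin_ext (\<alpha> i) (DG i c)"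
    using chain_map_exists by auto
  have "poly_res V (monomial_ideal V (insert E \<E>)) (cone_basis BF BG) (cone_deg dF dG (int (card E))) (cone_diff DF DG \<alpha>) (cone_aug eF)"
    by (rule cone[OF \<alpha> monomial_ideal_graded_ideal monomial_ideal_insert[OF assms(1,2)]])
  moreover have "cone_deg dF dG (int (card E)) i b \<le> int i + w" if "b \<in> cone_basis BF BG i" for i b
  proof (cases "even b")
    case True
    then show ?thesis using that wF by (simp add: cone_basis_def cone_deg_def)
  next
    case False
    then have "i \<noteq> 0" "dG (i - 1) (b div 2) \<le> int (i - 1) + w'"
      using that wG[of "b div 2" "i - 1"] by (simp_all add: cone_basis_def)
    then show ?thesis using assms(5) False by (simp add: cone_deg_def of_nat_diff)
  qed
  ultimately show ?thesis unfolding has_res_def by blast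
qed

section \<open>Induction on the number of edges\<close>

definition collage_weight :: "'v set set \<Rightarrow> nat" where
  "collage_weight \<C> = (\<Sum>F\<in>\<C>. card F - 1)"

text \<open>Distinct members may become equal under \<open>f\<close>, which can only lower the
  sum.\<close>

lemma collage_weight_image_le:
  "finite \<C> \<Longrightarrow> collage_weight (f ` \<C>) \<le> (\<Sum>F\<in>\<C>. card (f F) - 1)"
  unfolding collage_weight_def by (rule sum_image_le[unfolded o_def]) auto

text \<open>If \<open>E\<close> contains another edge, its monomial already lies in the ideal and
  nothing changes. Otherwise the cone is used, and only then is the numerical hypothesis on the sets
  F - E invoked.\<close>

lemma has_res_insert_collage:
  fixes V :: "'v set" and \<E> \<C> :: "'v set set" and k :: "'k::field itself"
  assumes V: "finite V" and E: "E \<subseteq> V" "E \<noteq> {}" and sub: "\<E> \<subseteq> Pow V" "{} \<notin> \<E>"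
    and \<C>: "two_collage \<E> \<C>"
    and IH: "\<And>\<E>' \<C>'. card \<E>' \<le> card \<E> \<Longrightarrow> \<E>' \<subseteq> Pow V \<Longrightarrow> {} \<notin> \<E>' \<Longrightarrow> two_collage \<E>' \<C>' \<Longrightarrow>
        has_res k V \<E>' (int (collage_weight \<C>'))"
    and w: "int (collage_weight \<C>) \<le> w"
      "(\<And>E'. E' \<in> \<E> \<Longrightarrow> \<not> E' \<subseteq> E) \<Longrightarrow>
        int (\<Sum>F\<in>\<C>. card (F - E) - 1) + int (card E) - 1 \<le> w"
  shows "has_res k V (insert E \<E>) w"
proof (cases "\<exists>E'\<in>\<E>. E' \<subseteq> E")
  case True
  then have "(\<exists>E'\<in>insert E \<E>. E' \<subseteq> M) \<longleftrightarrow> (\<exists>E'\<in>\<E>. E' \<subseteq> M)" for M by blast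
  then have "monomial_ideal V (insert E \<E>) = (monomial_ideal V \<E> :: ('v, 'k) mpoly set)" unfolding monomial_ideal_def by simp
  moreover have "has_res k V \<E> w" using has_res_mono IH \<C> sub w(1) by blast
  ultimately show ?thesis by (simp add: has_res_def)
next
  case False
  have fin: "finite \<E>" using V sub(1) by (metis finite_Pow_iff finite_subset)
  let ?\<E>' = "(\<lambda>E'. E' - E) ` \<E>" and ?\<C>' = "(\<lambda>F. F - E) ` \<C>"
  have "two_collage ?\<E>' ?\<C>'"
    unfolding two_collage_def
  proof (intro conjI ballI)
    show "?\<C>' \<subseteq> ?\<E>'" using \<C> by (auto simp: two_collage_def)
    fix D assume "D \<in> ?\<E>'"
    then obtain E' where E': "E' \<in> \<E>" "D = E' - E" by blast
    then obtain u F where u: "u \<in> E'" "F \<in> \<C>" "E' - {u} \<subseteq> F" using \<C> by (auto simp: two_collage_def)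
    \<comment> \<open>If the exempted vertex \<open>u\<close> lies in \<open>E\<close>, it
      disappears from E' - E, and then any vertex of this nonempty set may be exempted
      instead.\<close>
    obtain u' where "u' \<in> D" "u \<in> E \<or> u' = u" using False E' u(1) by blast
    then have "u' \<in> D" "D - {u'} \<subseteq> F - E" using u(3) E'(2) by auto
    then show "\<exists>v\<in>D. \<exists>F\<in>?\<C>'. D - {v} \<subseteq> F" using u(2) by blast
  qed
  moreover have "card ?\<E>' \<le> card \<E>" by (rule card_image_le[OF fin])
  moreover have "?\<E>' \<subseteq> Pow V" "{} \<notin> ?\<E>'" using sub False by auto
  ultimately have colon: "has_res k V ?\<E>' (int (collage_weight ?\<C>'))" using IH by blast
  have base: "has_res k V \<E> w" using has_res_mono IH \<C> sub w(1) by blast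
  have "finite \<C>" using \<C> fin by (auto simp: two_collage_def intro: finite_subset)
  then have "int (collage_weight ?\<C>') \<le> int (\<Sum>F\<in>\<C>. card (F - E) - 1)"
    by (intro of_nat_mono collage_weight_image_le)
  moreover have "int (\<Sum>F\<in>\<C>. card (F - E) - 1) + int (card E) - 1 \<le> w"
    using w(2) False by blast
  ultimately have "int (collage_weight ?\<C>') + int (card E) - 1 \<le> w" by linarith
  with colon base show ?thesis
    by (intro has_res_insert[of E V k \<E> w]) (use E V in \<open>auto intro: finite_subset\<close>)
qed

lemma two_collage_self:
  assumes "{} \<notin> \<E>"
  shows "two_collage \<E> \<E>"
  unfolding two_collage_def
proof (intro conjI ballI)
  fix E assume "E \<in> \<E>"
  moreover from this obtain v where "v \<in> E" using assms by (metis all_not_in_conv)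
  ultimately show "\<exists>v\<in>E. \<exists>F\<in>\<E>. E - {v} \<subseteq> F" by blast
qed simp

lemma collage_resolution:
  fixes V :: "'v set"
  assumes "finite V" "\<E> \<subseteq> Pow V" "{} \<notin> \<E>" "two_collage \<E> \<C>"
  shows "has_res k V \<E> (int (collage_weight \<C>))"
  using assms(2-4)
proof (induction "card \<E>" arbitrary: \<E> \<C> rule: less_induct)
  case less
  have fin: "finite \<E>" using assms(1) less.prems(1) by (metis finite_Pow_iff finite_subset)
  have \<C>sub: "\<C> \<subseteq> \<E>" using less.prems(3) by (simp add: two_collage_def)
  have fin\<C>: "finite \<C>" using \<C>sub fin by (rule finite_subset)
  have finE: "finite E" if "E \<in> \<E>" for E
    using that less.prems(1) assms(1) by (auto intro: finite_subset)
  \<comment> \<open>Both choices of the removed edge end here; the bound is arranged as a sum in the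
    natural numbers, so that |E| - 1 is not truncated.\<close>
  have step: "has_res k V \<E> (int (collage_weight \<C>))"
    if E: "E \<in> \<E>" and \<C>': "two_collage (\<E> - {E}) \<C>'"
      and w: "collage_weight \<C>' \<le> collage_weight \<C>"
        "(\<And>E'. E' \<in> \<E> - {E} \<Longrightarrow> \<not> E' \<subseteq> E) \<Longrightarrow>
          (\<Sum>F\<in>\<C>'. card (F - E) - 1) + card E \<le> collage_weight \<C> + 1" for E \<C>'
  proof -
    have "card (\<E> - {E}) < card \<E>" using E fin by (meson card_Diff1_less)
    then have IH: "has_res k V \<E>' (int (collage_weight \<C>''))"
      if "card \<E>' \<le> card (\<E> - {E})" "\<E>' \<subseteq> Pow V" "{} \<notin> \<E>'" "two_collage \<E>' \<C>''" for \<E>' \<C>''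
      using less.hyps that by (meson le_less_trans)
    have "int (\<Sum>F\<in>\<C>'. card (F - E) - 1) + int (card E) - 1 \<le> int (collage_weight \<C>)"
      if "\<And>E'. E' \<in> \<E> - {E} \<Longrightarrow> \<not> E' \<subseteq> E"
      using w(2)[OF that] by linarith
    with w(1) have "has_res k V (insert E (\<E> - {E})) (int (collage_weight \<C>))"
      using E less.prems(1,2)
      by (intro has_res_insert_collage[OF assms(1) _ _ _ _ \<C>' IH]) auto
    then show ?thesis using E by (simp add: insert_absorb)
  qed
  show ?case
  proof (cases "\<E> \<subseteq> \<C>")
    case True
    then have eq: "\<C> = \<E>" using \<C>sub by blast
    show ?thesis
    proof (cases "\<E> = {}")
      case True
      then show ?thesis using has_res_empty by (simp add: collage_weight_def eq)
    next
      case False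
      then obtain E where E: "E \<in> \<E>" by blast
      have cw: "collage_weight \<C> = collage_weight (\<C> - {E}) + (card E - 1)"
        using E eq fin by (simp add: collage_weight_def sum.remove)
      have "card E \<ge> 1" using E finE less.prems(2) by (metis One_nat_def Suc_leI card_gt_0_iff)
      moreover have "(\<Sum>F\<in>\<C> - {E}. card (F - E) - 1) \<le> collage_weight (\<C> - {E})"
        unfolding collage_weight_def using finE eq
        by (intro sum_mono diff_le_mono card_mono) auto
      moreover have "two_collage (\<E> - {E}) (\<C> - {E})"
        unfolding eq by (rule two_collage_self) (use less.prems(2) in blast)
      ultimately show ?thesis using E cw by (intro step[of E "\<C> - {E}"]) auto
    qed
  next
    case False
    then obtain E where E: "E \<in> \<E>" "E \<notin> \<C>" by blast
    then obtain v F where F: "v \<in> E" "F \<in> \<C>" "E - {v} \<subseteq> F"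
      using less.prems(3) unfolding two_collage_def by blast
    have "two_collage (\<E> - {E}) \<C>"
      using less.prems(3) E by (auto simp: two_collage_def)
    moreover have "(\<Sum>F\<in>\<C>. card (F - E) - 1) + card E \<le> collage_weight \<C> + 1"
      if nsub: "\<And>E'. E' \<in> \<E> - {E} \<Longrightarrow> \<not> E' \<subseteq> E"
    proof -
      have finF: "finite F" using F \<C>sub finE by blast
      \<comment> \<open>As E is outside \<C>, the set F differs from it and cannot lie inside it, so
        |F - E| - 1 is not truncated. Since F meets E in at least |E| - 1 vertices, the weight drops
        by at least that much.\<close>
      have "\<not> F \<subseteq> E" using nsub F E \<C>sub by blast
      then have "card (F - E) \<ge> 1"
        using finF by (metis One_nat_def Suc_leI card_gt_0_iff Diff_eq_empty_iff finite_Diff)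
      moreover have "card E - 1 \<le> card (F \<inter> E)"
        using F finF by (metis Int_greatest Diff_subset card_Diff_singleton card_mono finite_Int)
      moreover have "card F = card (F - E) + card (F \<inter> E)"
        using finF by (metis Un_Diff_Int card_Un_disjoint Diff_Int_distrib2 Diff_disjoint finite_Diff
            finite_Int inf_commute Int_Diff Int_empty_right)
      ultimately have 1: "(card (F - E) - 1) + card E \<le> card F - 1 + 1" by linarith
      have "(\<Sum>F\<in>\<C> - {F}. card (F - E) - 1) \<le> (\<Sum>F\<in>\<C> - {F}. card F - 1)"
        using finE \<C>sub by (intro sum_mono diff_le_mono card_mono) auto
      with 1 show ?thesis
        unfolding collage_weight_def using F(2) fin\<C> by (simp add: sum.remove)
    qed
    ultimately show ?thesis using E by (intro step[of E \<C>]) auto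
  qed
qed


section \<open>Comparison with the given graded modules\<close>

lemma coset_eq: "J +>\<^bsub>poly_ring V\<^esub> p = (\<lambda>h. h + p) ` J"
  by (auto simp: a_r_coset_def' poly_ring_simps)

lemma coset_eq_iff:
  assumes "graded_ideal V J"
  shows "J +>\<^bsub>poly_ring V\<^esub> p = J +>\<^bsub>poly_ring V\<^esub> q \<longleftrightarrow> p - q \<in> J"
proof
  assume "J +>\<^bsub>poly_ring V\<^esub> p = J +>\<^bsub>poly_ring V\<^esub> q"
  moreover have "p \<in> J +>\<^bsub>poly_ring V\<^esub> p"
    unfolding coset_eq using graded_idealD(2)[OF assms] by (intro image_eqI[of _ _ 0]) auto
  ultimately obtain h where "h \<in> J" "p = h + q" unfolding coset_eq by auto
  then show "p - q \<in> J" by simp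
next
  assume *: "p - q \<in> J"
  note J = graded_idealD[OF assms]
  have "h + p \<in> (\<lambda>h. h + q) ` J" if "h \<in> J" for h
    using J(3)[OF that *] by (intro image_eqI[of _ _ "h + (p - q)"]) (auto simp: algebra_simps)
  moreover have "h + q \<in> (\<lambda>h. h + p) ` J" if "h \<in> J" for h
    using J(7)[OF that *] by (intro image_eqI[of _ _ "h - (p - q)"]) (auto simp: algebra_simps)
  ultimately show "J +>\<^bsub>poly_ring V\<^esub> p = J +>\<^bsub>poly_ring V\<^esub> q" unfolding coset_eq by blast
qed

lemma coset_zero: "J +>\<^bsub>poly_ring V\<^esub> 0 = J"
  by (simp add: coset_eq)

lemma quot_module_simps:
  "carrier (quot_module V J) = (\<lambda>p. J +>\<^bsub>poly_ring V\<^esub> p) ` PR V"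
  "zero (quot_module V J) = J"
  "component (quot_module V J) d = {J +>\<^bsub>poly_ring V\<^esub> p | p. p \<in> PR V \<and> homogeneous d p}"
  by (auto simp: quot_module_def Let_def FactRing_def A_RCOSETS_def')

text \<open>The coset map is a ring homomorphism, so it carries the polynomial sum in
  \<open>aug_eval\<close> to the \<open>finsum\<close> in \<open>aug_map\<close>.\<close>

lemma aug_map_quot_module:
  assumes J: "graded_ideal V J" and f: "f \<in> FM V (basis F 0)"
    and e: "\<And>b. b \<in> basis F 0 \<Longrightarrow> aug F b = J +>\<^bsub>poly_ring V\<^esub> e b"
      "\<And>b. b \<in> basis F 0 \<Longrightarrow> e b \<in> PR V"
  shows "aug_map (quot_module V J) F f = J +>\<^bsub>poly_ring V\<^esub> aug_eval e f"
proof -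
  interpret ideal J "poly_ring V" by (rule graded_ideal_ideal[OF J])
  define Q where "Q = poly_ring V Quot J"
  interpret Q: ring Q unfolding Q_def by (rule quotient_is_ring)
  note hom = rcos_ring_hom[folded Q_def]
  note hom_mem = ring_hom_closed[OF hom] and hom_mult = ring_hom_mult[OF hom]
    and hom_add = ring_hom_add[OF hom] 
  let ?c = "\<lambda>p. J +>\<^bsub>poly_ring V\<^esub> p"
  define M where "M = quot_module V J"
  have M: "carrier M = carrier Q" "add M = add Q" "zero M = zero Q" "smult M r X = ?c r \<otimes>\<^bsub>Q\<^esub> X" for r X
    by (simp_all add: M_def Q_def quot_module_def Let_def)
  \<comment> \<open>M has the addition of the quotient ring, and this interpretation supplies the
    laws of \<open>finsum\<close> for it.\<close>
  interpret M: abelian_monoid M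
    by (rule abelian_monoidI) (auto simp: M Q.a_ac)
  have "aug_map M F f = finsum M (\<lambda>b. ?c (lookup f b) \<otimes>\<^bsub>Q\<^esub> aug F b) (keys f)"
    by (simp add: aug_map_def M)
  moreover have "finsum M (\<lambda>b. ?c (lookup f b) \<otimes>\<^bsub>Q\<^esub> aug F b) A = ?c (\<Sum>b\<in>A. lookup f b * e b)"
    if "finite A" "A \<subseteq> keys f" for A
    using that
  proof (induction A)
    case empty
    have "zero M = J" by (simp add: M Q_def FactRing_def)
    then show ?case by (simp add: coset_zero)
  next
    case (insert b A)
    have b: "b' \<in> basis F 0" "lookup f b' \<in> PR V" "e b' \<in> PR V" if "b' \<in> insert b A" for b'
      using f e insert.prems that by (auto simp: FM_iff)
    have summand: "?c (lookup f b') \<otimes>\<^bsub>Q\<^esub> aug F b' = ?c (lookup f b' * e b')" if "b' \<in> insert b A" for b'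
      using hom_mult[OF b(2,3)[OF that]] e(1)[OF b(1)[OF that]] by (simp add: poly_ring_simps)
    have mem: "?c (lookup f b') \<otimes>\<^bsub>Q\<^esub> aug F b' \<in> carrier Q" if "b' \<in> insert b A" for b'
      unfolding summand[OF that] by (intro hom_mem PR_mult b that)
    have "finsum M (\<lambda>b. ?c (lookup f b) \<otimes>\<^bsub>Q\<^esub> aug F b) (insert b A)
        = ?c (lookup f b * e b) \<oplus>\<^bsub>Q\<^esub> ?c (\<Sum>b\<in>A. lookup f b * e b)"
      using insert mem by (subst M.finsum_insert) (auto simp: summand M)
    also have "\<dots> = ?c (lookup f b * e b + (\<Sum>b\<in>A. lookup f b * e b))"
      using b by (subst hom_add[symmetric]) (auto simp: poly_ring_simps intro!: PR_sum PR_mult)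
    finally show ?case using insert by simp
  qed
  from this[of "keys f"] have "finsum M (\<lambda>b. ?c (lookup f b) \<otimes>\<^bsub>Q\<^esub> aug F b) (keys f) = ?c (aug_eval e f)"
    by (simp add: aug_eval_sum)
  ultimately show ?thesis by (simp add: M_def)
qed

text \<open>Both directions serve the final theorem: one turns the constructed resolution into a
  \<open>free_complex\<close>, the other makes the chosen one accessible to the comparison.\<close>

lemma graded_free_resolution_iff_poly_res:
  assumes J: "graded_ideal V J"
    and e: "\<And>b. b \<in> basis F 0 \<Longrightarrow> aug F b = J +>\<^bsub>poly_ring V\<^esub> e b"
      "\<And>b. b \<in> basis F 0 \<Longrightarrow> e b \<in> PR V"
      "\<And>b. b \<in> basis F 0 \<Longrightarrow> homogeneous (bdeg F 0 b) (e b)"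
  shows "graded_free_resolution V (quot_module V J) F \<longleftrightarrow>
    poly_res V J (basis F) (bdeg F) (diff F) e"
proof -
  let ?M = "quot_module V J"
  note aug = aug_map_quot_module[OF J _ e(1,2)]
  have deg: "\<forall>b\<in>basis F 0. aug F b \<in> component ?M (bdeg F 0 b)"
    using e by (auto simp: quot_module_simps)
  have diff: "(diff F i c \<in> FM V (basis F i) \<and> (\<forall>b\<in>basis F i. homogeneous
        (bdeg F (Suc i) c - bdeg F i b) (lookup (diff F i c) b))) \<longleftrightarrow>
      diff F i c \<in> piece V (basis F i) (bdeg F i) (bdeg F (Suc i) c)" for i c
  proof -
    \<comment> \<open>Coefficients outside the basis are zero, hence homogeneous of every
      degree.\<close>
    have "homogeneous (bdeg F (Suc i) c - bdeg F i b) (lookup (diff F i c) b)"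
      if "diff F i c \<in> FM V (basis F i)" "\<forall>b\<in>basis F i. homogeneous
        (bdeg F (Suc i) c - bdeg F i b) (lookup (diff F i c) b)" for b
      using that by (cases "b \<in> basis F i") (auto simp: FM_iff in_keys_iff subset_iff, metis homogeneous_zero)
    then show ?thesis unfolding piece_def by blast
  qed
  have surj: "aug_map ?M F ` FM V (basis F 0) = carrier ?M \<longleftrightarrow>
      (\<forall>p\<in>PR V. \<exists>f\<in>FM V (basis F 0). p - aug_eval e f \<in> J)"
  proof -
    have im: "aug_map ?M F ` FM V (basis F 0) = (\<lambda>f. J +>\<^bsub>poly_ring V\<^esub> aug_eval e f) ` FM V (basis F 0)"
      by (rule image_cong) (auto simp: aug)
    have sub: "(\<lambda>f. J +>\<^bsub>poly_ring V\<^esub> aug_eval e f) ` FM V (basis F 0) \<subseteq> carrier ?M"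
      unfolding quot_module_simps using aug_eval_PR e(2) by blast
    have "carrier ?M \<subseteq> (\<lambda>f. J +>\<^bsub>poly_ring V\<^esub> aug_eval e f) ` FM V (basis F 0) \<longleftrightarrow>
        (\<forall>p\<in>PR V. \<exists>f\<in>FM V (basis F 0). p - aug_eval e f \<in> J)"
      unfolding quot_module_simps image_subset_iff image_iff coset_eq_iff[OF J] ..
    then show ?thesis unfolding im using sub by blast
  qed
  have ker: "{f \<in> FM V (basis F 0). aug_map ?M F f = \<zero>\<^bsub>?M\<^esub>} = {f \<in> FM V (basis F 0). aug_eval e f \<in> J}"
    using coset_eq_iff[OF J, of _ 0]
    by (intro Collect_cong conj_cong refl) (simp add: aug quot_module_simps coset_zero)
  have exact: "(\<forall>i. {f \<in> FM V (basis F i). cycle J (diff F) e i f} = lin_ext (diff F i) ` FM V (basis F (Suc i))) \<longleftrightarrow>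
      {f \<in> FM V (basis F 0). aug_eval e f \<in> J} = lin_ext (diff F 0) ` FM V (basis F 1) \<and>
      (\<forall>i. {f \<in> FM V (basis F (Suc i)). lin_ext (diff F i) f = 0} =
        lin_ext (diff F (Suc i)) ` FM V (basis F (Suc (Suc i))))"
  proof -
    have "(\<forall>i. P i) \<longleftrightarrow> P 0 \<and> (\<forall>i. P (Suc i))" for P :: "nat \<Rightarrow> bool"
      by (metis not0_implies_Suc)
    from this[of "\<lambda>i. {f \<in> FM V (basis F i). cycle J (diff F) e i f} = lin_ext (diff F i) ` FM V (basis F (Suc i))"]
    show ?thesis by simp
  qed
  have "poly_res V J (basis F) (bdeg F) (diff F) e \<longleftrightarrow>
      (\<forall>i. \<forall>c\<in>basis F (Suc i). diff F i c \<in> piece V (basis F i) (bdeg F i) (bdeg F (Suc i) c)) \<and>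
      (\<forall>p\<in>PR V. \<exists>f\<in>FM V (basis F 0). p - aug_eval e f \<in> J) \<and>
      (\<forall>i. {f \<in> FM V (basis F i). cycle J (diff F) e i f} = lin_ext (diff F i) ` FM V (basis F (Suc i)))"
    unfolding poly_res_def using J e(2,3) by meson
  then show ?thesis
    unfolding graded_free_resolution_def diff surj ker exact using deg by simp
qed

section \<open>Vanishing of Tor and the regularity bound\<close>

lemma trivial_group_Mod_carrier:
  assumes "group G"
  shows "trivial_group (G Mod carrier G)"
proof -
  interpret group G by fact
  interpret normal "carrier G" G
    by (rule normalI[OF subgroup_self]) (simp add: coset_join2 coset_join3 subgroup_self)
  have "rcosets\<^bsub>G\<^esub> (carrier G) = {carrier G}"
    by (auto simp: RCOSETS_def coset_join2 subgroup_self intro!: bexI[of _ "\<one>\<^bsub>G\<^esub>"])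
  then show ?thesis
    using factorgroup_is_group by (simp add: trivial_group_def FactGroup_def)
qed

text \<open>Once all cycles are boundaries, the homology is a group modulo its full carrier.\<close>

lemma tensor_homology_trivial:
  fixes F :: "('v, 'k::field, 'm) free_complex"
  assumes F: "poly_res V J (basis F) (bdeg F) (diff F) e"
    and boundary: "\<And>z. z \<in> reduced_piece (basis F) (bdeg F) i j \<Longrightarrow> reduced_cycle (diff F) i z \<Longrightarrow>
      \<exists>y\<in>reduced_piece (basis F) (bdeg F) (Suc i) j. reduced_diff (diff F) i y = z"
  shows "trivial_group (tensor_homology F i j)"
proof -
  interpret poly_res V J "basis F" "bdeg F" "diff F" e by (rule F)
  let ?Z = "{z \<in> reduced_piece (basis F) (bdeg F) i j. reduced_cycle (diff F) i z}"
  have Z: "tensor_cycles F i j = ?Z"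
    by (auto simp: tensor_cycles_def tensor_k_def reduced_piece_def reduced_cycle_def tensor_diff_def reduced_diff_def split: nat.splits)
  have H: "tensor_diff F i ` tensor_k F (Suc i) j = ?Z"
  proof -
    have "reduced_cycle (diff F) i (reduced_diff (diff F) i y)" if "y \<in> reduced_piece (basis F) (bdeg F) (Suc i) j" for y
      using that reduced_diff_reduced_diff by (auto simp: reduced_cycle_def split: nat.splits)
    then have "reduced_diff (diff F) i ` reduced_piece (basis F) (bdeg F) (Suc i) j = ?Z"
      using reduced_diff_reduced_piece boundary by blast
    then show ?thesis by (simp add: tensor_diff_def reduced_diff_def tensor_k_def reduced_piece_def)
  qed
  let ?G = "\<lparr>carrier = ?Z, mult = (+), one = 0\<rparr> :: (nat \<Rightarrow>\<^sub>0 'k) monoid"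
  have "group ?G"
  proof (rule groupI)
    fix x y assume "x \<in> carrier ?G" "y \<in> carrier ?G"
    then show "x \<otimes>\<^bsub>?G\<^esub> y \<in> carrier ?G"
      using keys_add[of x y] by (auto simp: reduced_piece_def reduced_cycle_def reduced_diff_def lin_ext_add split: nat.splits)
  next
    fix x assume "x \<in> carrier ?G"
    then have "- x \<in> carrier ?G"
      by (auto simp: reduced_piece_def reduced_cycle_def reduced_diff_def lin_ext_uminus in_keys_iff split: nat.splits)
    then show "\<exists>y\<in>carrier ?G. y \<otimes>\<^bsub>?G\<^esub> x = \<one>\<^bsub>?G\<^esub>" by (auto intro!: bexI[of _ "- x"])
  qed (auto simp: reduced_piece_def reduced_cycle_def reduced_diff_def algebra_simps split: nat.splits)
  from trivial_group_Mod_carrier[OF this] show ?thesis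
    by (simp add: tensor_homology_def Z H)
qed

theorem theorem1p2:
  fixes V :: "'v set" and \<E> \<C> :: "'v set set" and I :: "('v, 'k::field) mpoly set"
  assumes "simple_hypergraph V \<E>"
    and "I = edge_ideal V \<E>"
    and "two_collage \<E> \<C>"
  shows "regularity V (quot_module V I) \<le> ereal (real (\<Sum>E\<in>\<C>. (card E - 1)))"
proof -
  have hyp: "hypergraph V \<E>" using assms(1) by (simp add: simple_hypergraph_def)
  have I: "I = monomial_ideal V \<E>" using edge_ideal_eq_monomial_ideal[OF hyp] assms(2) by simp
  have ideal: "graded_ideal V I" unfolding I by (rule monomial_ideal_graded_ideal)
  have "has_res TYPE('k) V \<E> (int (collage_weight \<C>))"
    by (rule collage_resolution) (use hyp assms(3) in \<open>auto simp: hypergraph_def\<close>)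
  then obtain B dg D e where G: "poly_res V I B dg D e"
    and deg: "\<And>i b. b \<in> B i \<Longrightarrow> dg i b \<le> int i + int (collage_weight \<C>)"
    unfolding has_res_def I by metis
  define M where "M = quot_module V I"
  define F where "F = (SOME F. graded_free_resolution V M F)"
  interpret G: poly_res V I B dg D e by (rule G)
  \<comment> \<open>The constructed resolution as a record: its existence guarantees that the choice
    operator in \<open>Tor_k\<close> returns a genuine resolution.\<close>
  define G' :: "('v, 'k, ('v, 'k) mpoly set) free_complex"
    where "G' = \<lparr>basis = B, bdeg = dg, diff = D, aug = (\<lambda>b. I +>\<^bsub>poly_ring V\<^esub> e b)\<rparr>"
  have "graded_free_resolution V M G'"
    unfolding M_def
    by (subst graded_free_resolution_iff_poly_res[OF ideal, of _ e])
      (use G in \<open>auto simp: G'_def G.aug_PR G.aug_hom\<close>)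
  then have F: "graded_free_resolution V M F"
    unfolding F_def by (rule someI)
  \<comment> \<open>The chosen augmentation takes values in cosets; homogeneous representatives of
    them are selected.\<close>
  then have "\<exists>p\<in>PR V. homogeneous (bdeg F 0 b) p \<and> aug F b = I +>\<^bsub>poly_ring V\<^esub> p"
    if "b \<in> basis F 0" for b
    using that by (auto simp: graded_free_resolution_def M_def quot_module_simps)
  then obtain eF where eF: "\<And>b. b \<in> basis F 0 \<Longrightarrow> eF b \<in> PR V"
    "\<And>b. b \<in> basis F 0 \<Longrightarrow> homogeneous (bdeg F 0 b) (eF b)"
    "\<And>b. b \<in> basis F 0 \<Longrightarrow> aug F b = I +>\<^bsub>poly_ring V\<^esub> eF b" by metis
  have Fp: "poly_res V I (basis F) (bdeg F) (diff F) eF"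
    using F graded_free_resolution_iff_poly_res[OF ideal eF(3,1,2)] unfolding M_def by blast
  \<comment> \<open>Above the bound the constructed resolution has no generator of degree
    \<open>j\<close> in its \<open>i\<close>-th term, which forces the homology of the chosen
    resolution to vanish there.\<close>
  have "trivial_group (Tor_k V M i j)" if "j - int i > int (collage_weight \<C>)" for i j
  proof -
    have "dg i b \<noteq> j" if "b \<in> B i" for b
      using deg[OF that] \<open>j - int i > int (collage_weight \<C>)\<close> by linarith
    then have "trivial_group (tensor_homology F i j)"
      by (intro tensor_homology_trivial[OF Fp]) (rule tensor_exact_where_other_resolution_vanishes[OF Fp G])
    then show ?thesis by (simp add: Tor_k_def F_def)
  qed
  then have "j - int i \<le> int (collage_weight \<C>)" if "\<not> trivial_group (Tor_k V M i j)" for i j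
    using that by (meson not_le)
  then have "ereal (real_of_int (j - int i)) \<le> ereal (real (collage_weight \<C>))"
    if "\<not> trivial_group (Tor_k V M i j)" for i j
    using that by (metis ereal_less_eq(3) of_int_le_iff of_int_of_nat_eq)
  then show ?thesis
    unfolding regularity_def M_def[symmetric] collage_weight_def[symmetric] by (intro Sup_least) auto
qed

end
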